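(* Suppose (A1), (A3) and (A4) hold. Then there exists $\tau^*>0$ such that $\{z\in\mathbb C:|z|>1\}\subset\rho(\Delta(\tau))$ for all $\tau\in(0,\tau^* )$.
   Context: $X$ is a complex Hilbert space. $A$ is a Riesz-spectral operator on $X$: a closed linear operator with simple, pairwise distinct eigenvalues $(\lambda_n)_{n\in\mathbb N}$ having at most finitely many accumulation points, whose eigenvectors $(\phi_n)$ form a Riesz basis of $X$; $(\psi_n)$ are eigenvectors of $A^*$ with $\langle\phi_n,\psi_m\rangle=\delta_{nm}$; $Ax=\sum_n\lambda_n\langle x,\psi_n\rangle\phi_n$, and $A$ generates $T(t)x=\sum_ne^{t\lambda_n}\langle x,\psi_n\rangle\phi_n$. $\mathcal D^{\beta}=\{x:\sum_n|\lambda_n|^{2\beta}|\langle x,\psi_n\rangle|^2<\infty\}$, $\mathcal D^{\gamma}_*=\{x:\sum_n|\lambda_n|^{2\gamma}|\langle x,\phi_n\rangle|^2<\infty\}$, $\mathbb C_\omega=\{\mathrm{Re}\,\lambda>\omega\}$, $\Omega_{\alpha,\Upsilon}=\{\lambda\in\mathbb C\setminus\mathbb R:\mathrm{Re}\,\lambda\le-\Upsilon/|\mathrm{Im}\,\lambda|^\alpha\}$. $b,f\in X$, $Bu=bu$, $Fx=\langle x,f\rangle$, $S(\tau)u=\int_0^\tau T(s)bu\,ds$, $\Delta(\tau)=T(\tau)+S(\tau)F$. Polynomially stable with parameter $\alpha$: uniformly bounded semigroup, $i\mathbb R$ in the resolvent set of the generator $G$, and $\|T(t)G^{-1}\|=O(t^{-1/\alpha})$.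 (A1) there exist $\omega,\alpha,\Upsilon>0$ such that only finitely many $\lambda_n$ lie in $\mathbb C_{-\omega}\cap(\mathbb C\setminus\Omega_{\alpha,\Upsilon})$; (A3) $A+BF$ generates a polynomially stable $C_0$-semigroup with parameter $\alpha$; (A4) there are $\beta,\gamma\ge0$ with $b\in\mathcal D^\beta$, $f\in\mathcal D^\gamma_*$, and either ($\beta,\gamma\in\mathbb N\cup\{0\}$ and $\beta+\gamma\ge\alpha$) or $\beta+\gamma>\alpha$. *)

theory Defs
  imports "HOL-Analysis.Analysis"
begin

text \<open>A complex Hilbert space is modelled as a real Hilbert space (type class
real_inner + complete_space) together with an orthogonal complex structure J
(multiplication by the imaginary unit).\<close>

definition complex_structure :: "('a::real_inner \<Rightarrow> 'a) \<Rightarrow> bool" where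
  "complex_structure J \<longleftrightarrow> linear J \<and> (\<forall>x. J (J x) = - x) \<and> (\<forall>x y. inner (J x) (J y) = inner x y)"

definition scaleC :: "('a::real_vector \<Rightarrow> 'a) \<Rightarrow> complex \<Rightarrow> 'a \<Rightarrow> 'a" where
  "scaleC J c x = Re c *\<^sub>R x + Im c *\<^sub>R J x"

text \<open>complex inner product, linear in the first argument, conjugate linear in the second\<close>
definition cinner :: "('a::real_inner \<Rightarrow> 'a) \<Rightarrow> 'a \<Rightarrow> 'a \<Rightarrow> complex" where
  "cinner J x y = Complex (inner x y) (inner x (J y))"

definition bounded_clinear :: "('a::real_normed_vector \<Rightarrow> 'a) \<Rightarrow> ('a \<Rightarrow> 'a) \<Rightarrow> bool" where
  "bounded_clinear J L \<longleftrightarrow> bounded_linear L \<and> (\<forall>x. L (J x) = J (L x))"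

definition riesz_basis :: "('a::real_inner \<Rightarrow> 'a) \<Rightarrow> (nat \<Rightarrow> 'a) \<Rightarrow> bool" where
  "riesz_basis J \<phi> \<longleftrightarrow>
     closure {(\<Sum>n<N. scaleC J (a n) (\<phi> n)) | N a. True} = UNIV \<and>
     (\<exists>m M. 0 < m \<and> 0 < M \<and>
        (\<forall>N (a::nat \<Rightarrow> complex).
           m * (\<Sum>n<N. (cmod (a n))\<^sup>2) \<le> (norm (\<Sum>n<N. scaleC J (a n) (\<phi> n)))\<^sup>2 \<and>
           (norm (\<Sum>n<N. scaleC J (a n) (\<phi> n)))\<^sup>2 \<le> M * (\<Sum>n<N. (cmod (a n))\<^sup>2)))"

definition riesz_spectral_data ::
  "('a::real_inner \<Rightarrow> 'a) \<Rightarrow> (nat \<Rightarrow> complex) \<Rightarrow> (nat \<Rightarrow> 'a) \<Rightarrow> (nat \<Rightarrow> 'a) \<Rightarrow> bool" where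
  "riesz_spectral_data J lam \<phi> \<psi> \<longleftrightarrow>
     inj lam \<and> finite {z. z islimpt (range lam)} \<and> riesz_basis J \<phi> \<and>
     (\<forall>n m. cinner J (\<phi> n) (\<psi> m) = (if n = m then 1 else 0))"

definition rs_dom :: "('a::real_inner \<Rightarrow> 'a) \<Rightarrow> (nat \<Rightarrow> complex) \<Rightarrow> (nat \<Rightarrow> 'a) \<Rightarrow> 'a set" where
  "rs_dom J lam \<psi> = {x. summable (\<lambda>n. (cmod (lam n))\<^sup>2 * (cmod (cinner J x (\<psi> n)))\<^sup>2)}"

definition rs_op ::
  "('a::real_inner \<Rightarrow> 'a) \<Rightarrow> (nat \<Rightarrow> complex) \<Rightarrow> (nat \<Rightarrow> 'a) \<Rightarrow> (nat \<Rightarrow> 'a) \<Rightarrow> 'a \<Rightarrow> 'a" where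
  "rs_op J lam \<phi> \<psi> x = (\<Sum>n. scaleC J (lam n * cinner J x (\<psi> n)) (\<phi> n))"

definition rs_semigroup ::
  "('a::real_inner \<Rightarrow> 'a) \<Rightarrow> (nat \<Rightarrow> complex) \<Rightarrow> (nat \<Rightarrow> 'a) \<Rightarrow> (nat \<Rightarrow> 'a) \<Rightarrow> real \<Rightarrow> 'a \<Rightarrow> 'a" where
  "rs_semigroup J lam \<phi> \<psi> t x = (\<Sum>n. scaleC J (exp (complex_of_real t * lam n) * cinner J x (\<psi> n)) (\<phi> n))"

definition sample_S ::
  "('a::{real_inner,complete_space} \<Rightarrow> 'a) \<Rightarrow> (nat \<Rightarrow> complex) \<Rightarrow> (nat \<Rightarrow> 'a) \<Rightarrow> (nat \<Rightarrow> 'a) \<Rightarrow> 'a \<Rightarrow> real \<Rightarrow> complex \<Rightarrow> 'a" where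
  "sample_S J lam \<phi> \<psi> b \<tau> u = integral {0..\<tau>} (\<lambda>s. rs_semigroup J lam \<phi> \<psi> s (scaleC J u b))"

definition Delta ::
  "('a::{real_inner,complete_space} \<Rightarrow> 'a) \<Rightarrow> (nat \<Rightarrow> complex) \<Rightarrow> (nat \<Rightarrow> 'a) \<Rightarrow> (nat \<Rightarrow> 'a) \<Rightarrow> 'a \<Rightarrow> 'a \<Rightarrow> real \<Rightarrow> 'a \<Rightarrow> 'a" where
  "Delta J lam \<phi> \<psi> b f \<tau> x = rs_semigroup J lam \<phi> \<psi> \<tau> x + sample_S J lam \<phi> \<psi> b \<tau> (cinner J x f)"

definition bounded_resolvent_set :: "('a::real_normed_vector \<Rightarrow> 'a) \<Rightarrow> ('a \<Rightarrow> 'a) \<Rightarrow> complex set" where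
  "bounded_resolvent_set J L = {z. \<exists>R. bounded_clinear J R \<and>
      (\<forall>y. scaleC J z (R y) - L (R y) = y) \<and> (\<forall>x. R (scaleC J z x - L x) = x)}"

definition op_resolvent_set :: "('a::real_normed_vector \<Rightarrow> 'a) \<Rightarrow> 'a set \<Rightarrow> ('a \<Rightarrow> 'a) \<Rightarrow> complex set" where
  "op_resolvent_set J D G = {z. \<exists>R. bounded_clinear J R \<and> range R \<subseteq> D \<and>
      (\<forall>y. scaleC J z (R y) - G (R y) = y) \<and> (\<forall>x\<in>D. R (scaleC J z x - G x) = x)}"

definition c0_semigroup :: "('a::real_normed_vector \<Rightarrow> 'a) \<Rightarrow> (real \<Rightarrow> 'a \<Rightarrow> 'a) \<Rightarrow> bool" where
  "c0_semigroup J U \<longleftrightarrow>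
     (\<forall>t\<ge>0. bounded_clinear J (U t)) \<and> U 0 = id \<and>
     (\<forall>s\<ge>0. \<forall>t\<ge>0. U (s + t) = U s \<circ> U t) \<and>
     (\<forall>x. ((\<lambda>t. U t x) \<longlongrightarrow> x) (at_right 0))"

definition is_generator :: "(real \<Rightarrow> 'a::real_normed_vector \<Rightarrow> 'a) \<Rightarrow> 'a set \<Rightarrow> ('a \<Rightarrow> 'a) \<Rightarrow> bool" where
  "is_generator U D G \<longleftrightarrow>
     D = {x. \<exists>y. ((\<lambda>h. inverse h *\<^sub>R (U h x - x)) \<longlongrightarrow> y) (at_right 0)} \<and>
     (\<forall>x\<in>D. ((\<lambda>h. inverse h *\<^sub>R (U h x - x)) \<longlongrightarrow> G x) (at_right 0))"

text \<open>(D,G) generates a polynomially stable C0-semigroup with parameter \<alpha>: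
  uniformly bounded, i\<real> \<subseteq> \<rho>(G), and \<parallel>U(t) G^(-1)\<parallel> = O(t^(-1/\<alpha>)) as t \<rightarrow> \<infinity>
  (the last written as \<parallel>U(t)x\<parallel> \<le> C t^(-1/\<alpha>) \<parallel>Gx\<parallel> for x \<in> D, t large, which is the
  operator norm bound since G : D \<rightarrow> X is bijective).\<close>
definition generates_poly_stable ::
  "('a::real_normed_vector \<Rightarrow> 'a) \<Rightarrow> 'a set \<Rightarrow> ('a \<Rightarrow> 'a) \<Rightarrow> real \<Rightarrow> bool" where
  "generates_poly_stable J D G \<alpha> \<longleftrightarrow>
     (\<exists>U. c0_semigroup J U \<and> is_generator U D G \<and>
        (\<exists>M. \<forall>t\<ge>0. \<forall>x. norm (U t x) \<le> M * norm x) \<and>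
        (\<forall>w::real. \<i> * complex_of_real w \<in> op_resolvent_set J D G) \<and>
        (\<exists>C t0. \<forall>t\<ge>t0. \<forall>x\<in>D. norm (U t x) \<le> C * t powr (- 1 / \<alpha>) * norm (G x)))"

definition Omega_set :: "real \<Rightarrow> real \<Rightarrow> complex set" where
  "Omega_set \<alpha> \<Upsilon> = {z. Im z \<noteq> 0 \<and> Re z \<le> - \<Upsilon> / \<bar>Im z\<bar> powr \<alpha>}"

definition D_beta :: "('a::real_inner \<Rightarrow> 'a) \<Rightarrow> (nat \<Rightarrow> complex) \<Rightarrow> (nat \<Rightarrow> 'a) \<Rightarrow> real \<Rightarrow> 'a set" where
  "D_beta J lam \<psi> \<beta> = {x. summable (\<lambda>n. cmod (lam n) powr (2 * \<beta>) * (cmod (cinner J x (\<psi> n)))\<^sup>2)}"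

definition D_gamma_star :: "('a::real_inner \<Rightarrow> 'a) \<Rightarrow> (nat \<Rightarrow> complex) \<Rightarrow> (nat \<Rightarrow> 'a) \<Rightarrow> real \<Rightarrow> 'a set" where
  "D_gamma_star J lam \<phi> \<gamma> = {x. summable (\<lambda>n. cmod (lam n) powr (2 * \<gamma>) * (cmod (cinner J x (\<phi> n)))\<^sup>2)}"

end

theory Submission
  imports Defs
begin

text \<open>
  For \<open>\<bar>z\<bar> > 1\<close> the operator \<open>\<Delta>(\<tau>)\<close> is a rank-one perturbation of the diagonal operator \<open>T(\<tau>)\<close>, so
  \<open>z\<close> is in its spectrum only if \<open>\<Sum>\<^sub>n c\<^sub>n \<sigma>\<^sub>n / (z - e\<^bsup>\<tau>\<lambda>\<^sub>n\<^esup>) = 1\<close>, where \<open>c\<^sub>n = \<langle>b, \<psi>\<^sub>n\<rangle>\<langle>\<phi>\<^sub>n, f\<rangle>\<close> and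
  \<open>\<sigma>\<^sub>n\<close> is the integral of \<open>e\<^bsup>s\<lambda>\<^sub>n\<^esup>\<close> over \<open>[0, \<tau>]\<close>. Putting \<open>z = 1 + \<tau>p\<close> and \<open>r\<^sub>n = \<sigma>\<^sub>n/\<tau> \<rightarrow> 1\<close>, the
  \<open>n\<close>-th term becomes \<open>c\<^sub>n r\<^sub>n / (p - \<lambda>\<^sub>n r\<^sub>n)\<close>. For \<open>Re \<lambda>\<^sub>n < 0\<close> it is at most \<open>\<bar>c\<^sub>n\<bar> / \<bar>Re \<lambda>\<^sub>n\<bar>\<close>
  uniformly in \<open>\<tau>\<close> and \<open>z\<close>, which is summable by (A1) and (A4). If the claim failed along some
  \<open>\<tau>\<^sub>k \<rightarrow> 0\<close>, dominated convergence would give a contradiction for every limit point of \<open>p\<^sub>k\<close>: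
  at infinity the sum tends to \<open>0\<close>; at a finite \<open>p\<close>, necessarily with \<open>Re p \<ge> 0\<close>, it tends to
  \<open>F(p - A)\<^sup>-\<^sup>1B\<close>, and the value \<open>1\<close> would make \<open>p\<close> an eigenvalue of \<open>A + BF\<close>; at \<open>p = \<lambda>\<^sub>m\<close>
  one gets \<open>c\<^sub>m = 0\<close>, so that \<open>\<lambda>\<^sub>m\<close> is an eigenvalue of \<open>A + BF\<close> or of its adjoint. The boundedness of the
  closed-loop semigroup and the absence of spectrum on the imaginary axis exclude both.
\<close>

text \<open>The library version needs class banach, which the sort {real_inner, complete_space} does not entail.\<close>

lemma has_integral_uniform_limit:
  fixes g :: "real \<Rightarrow> 'b::real_normed_vector"
  assumes ab: "a \<le> b"
    and int: "\<And>n. (h n has_integral I n) {a..b}"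
    and unif: "uniform_limit {a..b} h g sequentially"
    and lim: "I \<longlonglongrightarrow> L"
  shows "(g has_integral L) {a..b}"
  unfolding has_integral_real
proof (intro allI impI)
  fix e :: real assume "e > 0"
  \<comment> \<open>The summand 1 keeps the denominator positive when \<open>a = b\<close>; the
    total error is split into three parts below \<open>e / 3\<close>.\<close>
  define d where "d = e / 3 / (b - a + 1)"
  have d: "d > 0" "d * (b - a) < e / 3"
    using \<open>e > 0\<close> ab by (auto simp: d_def field_simps)
  have "\<forall>\<^sub>F n in sequentially. (\<forall>x\<in>{a..b}. dist (h n x) (g x) < d) \<and> dist (I n) L < e / 3"
    using uniform_limitD[OF unif d(1)] tendstoD[OF lim, of "e/3"] \<open>e > 0\<close> by (intro eventually_conj) simp_all
  from eventually_happens'[OF sequentially_bot this]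
  obtain n where n: "\<And>x. x \<in> {a..b} \<Longrightarrow> dist (h n x) (g x) < d" "dist (I n) L < e / 3"
    by blast
  obtain \<gamma> where \<gamma>: "gauge \<gamma>" "\<And>\<D>. \<D> tagged_division_of {a..b} \<Longrightarrow> \<gamma> fine \<D> \<Longrightarrow>
        norm ((\<Sum>(x,k)\<in>\<D>. measure lborel k *\<^sub>R h n x) - I n) < e / 3"
    using int[of n, unfolded has_integral_real, rule_format, of "e / 3"] \<open>e > 0\<close> by auto
  have "norm ((\<Sum>(x,k)\<in>\<D>. measure lborel k *\<^sub>R g x) - L) < e"
    if D: "\<D> tagged_division_of {a..b}" "\<gamma> fine \<D>" for \<D>
  proof -
    have "norm ((\<Sum>(x,k)\<in>\<D>. measure lborel k *\<^sub>R g x) - (\<Sum>(x,k)\<in>\<D>. measure lborel k *\<^sub>R h n x)) \<le> d * measure lborel (cbox a b)"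
      using D(1) n(1) d(1) by (intro rsum_diff_bound) (auto simp: dist_norm norm_minus_commute less_imp_le)
    moreover have "d * measure lborel (cbox a b) < e / 3" using d ab by simp
    moreover note \<gamma>(2)[OF D] n(2)
    ultimately show ?thesis
      using dist_triangle_third[of "\<Sum>(x,k)\<in>\<D>. measure lborel k *\<^sub>R g x" "\<Sum>(x,k)\<in>\<D>. measure lborel k *\<^sub>R h n x" e "I n" L]
      by (simp add: dist_norm)
  qed
  then show "\<exists>\<gamma>. gauge \<gamma> \<and> (\<forall>\<D>. \<D> tagged_division_of {a..b} \<and> \<gamma> fine \<D> \<longrightarrow>
        norm (sum (\<lambda>(x,k). measure lborel k *\<^sub>R g x) \<D> - L) < e)"
    using \<gamma>(1) by blast
qed

section \<open>Complex structures\<close>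

locale complex_hilbert =
  fixes J :: "'a::{real_inner,complete_space} \<Rightarrow> 'a"
  assumes complex_structure: "complex_structure J"
begin

abbreviation scaleC_J (infixr "*\<^sub>J" 75) where "c *\<^sub>J x \<equiv> scaleC J c x"
abbreviation cinner_J ("\<langle>_, _\<rangle>") where "\<langle>x, y\<rangle> \<equiv> cinner J x y"

lemma linear_J: "linear J" and J_J [simp]: "J (J x) = - x" and inner_J_J [simp]: "inner (J x) (J y) = inner x y"
  using complex_structure by (auto simp: complex_structure_def)

lemma norm_J [simp]: "norm (J x) = norm x"
  by (simp add: norm_eq_sqrt_inner)

lemmas J_simps [simp] = linear_add[OF linear_J] linear_diff[OF linear_J] linear_neg[OF linear_J]
  linear_scale[OF linear_J] linear_0[OF linear_J]

lemma inner_J_left: "inner (J x) y = - inner x (J y)"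
  using inner_J_J[of "J x" y] by simp

lemma inner_J_self: "inner x (J x) = 0"
  using inner_J_left[of x x] by (simp add: inner_commute)

lemma scaleC_simps [simp]:
  "0 *\<^sub>J x = 0" "1 *\<^sub>J x = x" "c *\<^sub>J 0 = 0" "c *\<^sub>J J x = J (c *\<^sub>J x)"
  by (auto simp: scaleC_def)

lemma scaleC_add_left: "(c + d) *\<^sub>J x = c *\<^sub>J x + d *\<^sub>J x"
  and scaleC_diff_left: "(c - d) *\<^sub>J x = c *\<^sub>J x - d *\<^sub>J x"
  and scaleC_add_right: "c *\<^sub>J (x + y) = c *\<^sub>J x + c *\<^sub>J y"
  and scaleC_scaleC: "c *\<^sub>J d *\<^sub>J x = (c * d) *\<^sub>J x"
  and scaleC_scaleR: "c *\<^sub>J (r *\<^sub>R x) = r *\<^sub>R (c *\<^sub>J x)"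
  and scaleR_scaleC_left: "(r *\<^sub>R c) *\<^sub>J x = r *\<^sub>R (c *\<^sub>J x)"
  and i_scaleC: "(\<i> * c) *\<^sub>J x = J (c *\<^sub>J x)"
  by (auto simp: scaleC_def algebra_simps)

lemma norm_scaleC [simp]: "norm (c *\<^sub>J x) = cmod c * norm x"
proof -
  have "(norm (c *\<^sub>J x))\<^sup>2 = (cmod c * norm x)\<^sup>2"
    unfolding power2_norm_eq_inner scaleC_def power_mult_distrib cmod_power2
    by (simp add: inner_simps inner_J_self inner_commute[of "J x" x] power2_eq_square algebra_simps inner_complex_def)
  then show ?thesis by (simp add: power2_eq_iff_nonneg)
qed

lemma bounded_linear_scaleC_left: "bounded_linear (\<lambda>c. c *\<^sub>J x)"
  by (rule bounded_linear_intro[of _ "norm x"]) (auto simp: scaleC_add_left scaleR_scaleC_left)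

lemma cinner_add_left: "\<langle>x + y, z\<rangle> = \<langle>x, z\<rangle> + \<langle>y, z\<rangle>"
  and cinner_diff_left: "\<langle>x - y, z\<rangle> = \<langle>x, z\<rangle> - \<langle>y, z\<rangle>"
  and cinner_scaleR_left: "\<langle>r *\<^sub>R x, z\<rangle> = r *\<^sub>R \<langle>x, z\<rangle>"
  and cinner_0_left [simp]: "\<langle>0, z\<rangle> = 0"
  and cinner_J_left: "\<langle>J x, z\<rangle> = \<i> * \<langle>x, z\<rangle>"
  by (auto simp: cinner_def complex_eq_iff inner_simps inner_J_left)

lemma cinner_scaleC_left: "\<langle>c *\<^sub>J x, y\<rangle> = c * \<langle>x, y\<rangle>"
  unfolding scaleC_def cinner_add_left cinner_scaleR_left cinner_J_left
  by (auto simp: complex_eq_iff)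

lemma cinner_sum_left: "\<langle>sum g S, y\<rangle> = (\<Sum>i\<in>S. \<langle>g i, y\<rangle>)"
  by (induction S rule: infinite_finite_induct) (auto simp: cinner_add_left)

lemma cinner_self: "\<langle>x, x\<rangle> = of_real ((norm x)\<^sup>2)"
  by (simp add: cinner_def complex_eq_iff power2_norm_eq_inner inner_J_self)

lemma cinner_commute: "\<langle>y, x\<rangle> = cnj \<langle>x, y\<rangle>"
  using inner_J_left[of x y] by (simp add: cinner_def complex_eq_iff inner_commute)

text \<open>The factor 2 arises because the real Cauchy-Schwarz inequality is applied to the real
  and the imaginary part separately.\<close>

lemma norm_cinner_le: "cmod \<langle>x, y\<rangle> \<le> 2 * norm x * norm y"
proof -
  have "cmod \<langle>x, y\<rangle> \<le> \<bar>inner x y\<bar> + \<bar>inner x (J y)\<bar>"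
    using cmod_le[of "\<langle>x, y\<rangle>"] by (simp add: cinner_def)
  then show ?thesis
    using Cauchy_Schwarz_ineq2[of x y] Cauchy_Schwarz_ineq2[of x "J y"] by simp
qed

lemma bounded_linear_cinner_left: "bounded_linear (\<lambda>x. \<langle>x, y\<rangle>)"
proof (rule bounded_linear_intro[of _ "2 * norm y"])
  show "norm \<langle>x, y\<rangle> \<le> norm x * (2 * norm y)" for x
    using norm_cinner_le[of x y] by (simp add: mult_ac)
qed (auto simp: cinner_add_left cinner_scaleR_left)

lemma bounded_clinear_add:
  "bounded_clinear J L \<Longrightarrow> bounded_clinear J L' \<Longrightarrow> bounded_clinear J (\<lambda>x. L x + L' x)"
  by (auto simp: bounded_clinear_def intro: bounded_linear_add)

lemma bounded_clinear_rank_one: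
  "bounded_clinear J L \<Longrightarrow> bounded_clinear J (\<lambda>x. (c * \<langle>L x, g\<rangle>) *\<^sub>J v)"
proof -
  assume L: "bounded_clinear J L"
  have "bounded_linear (\<lambda>x. c * \<langle>L x, g\<rangle>)"
    using L by (intro bounded_linear_const_mult bounded_linear_compose[OF bounded_linear_cinner_left])
      (auto simp: bounded_clinear_def)
  moreover have "(c * \<langle>L (J x), g\<rangle>) *\<^sub>J v = J ((c * \<langle>L x, g\<rangle>) *\<^sub>J v)" for x
    using L i_scaleC[of "c * \<langle>L x, g\<rangle>" v] by (simp add: bounded_clinear_def cinner_J_left mult.left_commute)
  ultimately show ?thesis
    unfolding bounded_clinear_def using bounded_linear_compose[OF bounded_linear_scaleC_left] by blast
qed

lemma bounded_clinear_id: "bounded_clinear J (\<lambda>x. x)"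
  by (auto simp: bounded_clinear_def)

lemma bounded_clinear_scaleC:
  assumes "bounded_clinear J L"
  shows "L (c *\<^sub>J x) = c *\<^sub>J L x"
proof -
  have "linear L" "L (J x) = J (L x)"
    using assms by (auto simp: bounded_clinear_def bounded_linear.linear)
  then show ?thesis
    by (simp add: scaleC_def linear_add linear_scale)
qed

end

section \<open>Square-summable complex sequences\<close>

definition square_summable :: "(nat \<Rightarrow> complex) \<Rightarrow> bool" where
  "square_summable a \<longleftrightarrow> summable (\<lambda>n. (cmod (a n))\<^sup>2)"

lemma square_summable_mult_bounded:
  assumes "\<And>n. cmod (d n) \<le> K" "square_summable a"
  shows "square_summable (\<lambda>n. d n * a n)"
  unfolding square_summable_def
proof (rule summable_comparison_test'[where N = 0])
  show "summable (\<lambda>n. K\<^sup>2 * (cmod (a n))\<^sup>2)"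
    using assms(2) by (simp add: square_summable_def)
  show "norm ((cmod (d n * a n))\<^sup>2) \<le> K\<^sup>2 * (cmod (a n))\<^sup>2" for n
    using power_mono[OF assms(1)[of n], of 2]
    by (simp add: norm_mult power_mult_distrib mult_right_mono)
qed

lemma square_summable_add:
  assumes "square_summable a" "square_summable a'"
  shows "square_summable (\<lambda>n. a n + a' n)"
  unfolding square_summable_def
proof (rule summable_comparison_test'[where N = 0])
  show "summable (\<lambda>n. 2 * (cmod (a n))\<^sup>2 + 2 * (cmod (a' n))\<^sup>2)"
    using assms by (auto simp: square_summable_def intro!: summable_add)
  show "norm ((cmod (a n + a' n))\<^sup>2) \<le> 2 * (cmod (a n))\<^sup>2 + 2 * (cmod (a' n))\<^sup>2" for n
  proof -
    have "(cmod (a n + a' n))\<^sup>2 \<le> (cmod (a n) + cmod (a' n))\<^sup>2"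
      by (simp add: norm_triangle_ineq power_mono)
    also have "\<dots> \<le> 2 * (cmod (a n))\<^sup>2 + 2 * (cmod (a' n))\<^sup>2"
      using sum_squares_bound[of "cmod (a n)" "cmod (a' n)"] by (simp add: power2_sum)
    finally show ?thesis by simp
  qed
qed

lemma square_summable_product:
  assumes "square_summable a" "square_summable a'"
  shows "summable (\<lambda>n. cmod (a n * a' n))"
proof (rule summable_comparison_test'[where N = 0])
  show "summable (\<lambda>n. (cmod (a n))\<^sup>2 + (cmod (a' n))\<^sup>2)"
    using assms by (auto simp: square_summable_def intro!: summable_add)
  show "norm (cmod (a n * a' n)) \<le> (cmod (a n))\<^sup>2 + (cmod (a' n))\<^sup>2" for n
    using sum_squares_bound[of "cmod (a n)" "cmod (a' n)"]
      mult_nonneg_nonneg[OF norm_ge_zero norm_ge_zero, of "a n" "a' n"]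
    unfolding real_norm_def norm_mult abs_mult abs_norm_cancel by linarith
qed

section \<open>Riesz bases and diagonal operators\<close>

locale riesz_system = complex_hilbert J
  for J :: "'a::{real_inner,complete_space} \<Rightarrow> 'a" +
  fixes \<phi> \<psi> :: "nat \<Rightarrow> 'a"
  assumes riesz_basis: "riesz_basis J \<phi>"
    and biorthogonal: "\<langle>\<phi> n, \<psi> m\<rangle> = (if n = m then 1 else 0)"
begin

definition synthesis :: "(nat \<Rightarrow> complex) \<Rightarrow> 'a" where
  "synthesis a = (\<Sum>n. a n *\<^sub>J \<phi> n)"

definition diagonal :: "(nat \<Rightarrow> complex) \<Rightarrow> 'a \<Rightarrow> 'a" where
  "diagonal d x = synthesis (\<lambda>n. d n * \<langle>x, \<psi> n\<rangle>)"

text \<open>Padding \<open>a\<close> with zeros carries the upper inequality from initial segments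
  over to any finite index set, in particular to the blocks \<open>{k..<l}\<close> of a Cauchy
  argument.\<close>

lemma riesz_bounds:
  obtains m M where "0 < m" "0 < M"
    "\<And>N a. m * (\<Sum>n<N. (cmod (a n))\<^sup>2) \<le> (norm (\<Sum>n<N. a n *\<^sub>J \<phi> n))\<^sup>2"
    "\<And>S a. finite S \<Longrightarrow> (norm (\<Sum>n\<in>S. a n *\<^sub>J \<phi> n))\<^sup>2 \<le> M * (\<Sum>n\<in>S. (cmod (a n))\<^sup>2)"
proof -
  obtain m M where *: "0 < m" "0 < M"
    "\<And>N a. m * (\<Sum>n<N. (cmod (a n))\<^sup>2) \<le> (norm (\<Sum>n<N. a n *\<^sub>J \<phi> n))\<^sup>2"
    "\<And>N a. (norm (\<Sum>n<N. a n *\<^sub>J \<phi> n))\<^sup>2 \<le> M * (\<Sum>n<N. (cmod (a n))\<^sup>2)"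
    using riesz_basis unfolding riesz_basis_def by blast
  have "(norm (\<Sum>n\<in>S. a n *\<^sub>J \<phi> n))\<^sup>2 \<le> M * (\<Sum>n\<in>S. (cmod (a n))\<^sup>2)" if "finite S" for S a
  proof -
    obtain N where N: "S \<subseteq> {..<N}" using \<open>finite S\<close> finite_nat_iff_bounded by blast
    have "(\<Sum>n<N. (if n \<in> S then a n else 0) *\<^sub>J \<phi> n) = (\<Sum>n\<in>S. a n *\<^sub>J \<phi> n)"
      using N by (intro sum.mono_neutral_cong_right) auto
    moreover have "(\<Sum>n<N. (cmod (if n \<in> S then a n else 0))\<^sup>2) = (\<Sum>n\<in>S. (cmod (a n))\<^sup>2)"
      using N by (intro sum.mono_neutral_cong_right) auto
    ultimately show ?thesis using *(4)[of "\<lambda>n. if n \<in> S then a n else 0" N] by simp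
  qed
  with * that show ?thesis by blast
qed

text \<open>Rests on density of the finite combinations of the basis; it reduces closed conditions,
  such as inequalities between continuous functions, to finite sums.\<close>

lemma dense_induct [case_names closed span]:
  assumes "closed {x. P x}" "\<And>N a. P (\<Sum>n<N. a n *\<^sub>J \<phi> n)"
  shows "P x"
proof -
  have "{(\<Sum>n<N. a n *\<^sub>J \<phi> n) | N a. True} \<subseteq> {x. P x}"
    using assms(2) by blast
  then have "closure {(\<Sum>n<N. a n *\<^sub>J \<phi> n) | N a. True} \<subseteq> {x. P x}"
    by (rule closure_minimal) (rule assms(1))
  then show ?thesis
    using riesz_basis by (auto simp: riesz_basis_def)
qed

lemma cinner_span: "\<langle>\<Sum>n<N. a n *\<^sub>J \<phi> n, \<psi> k\<rangle> = (if k < N then a k else 0)"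
  by (auto simp: cinner_sum_left cinner_scaleC_left biorthogonal if_distrib cong: if_cong)

text \<open>On finite combinations biorthogonality reads off the coefficients, so the lower Riesz
  inequality applies; both sides are continuous in \<open>x\<close>, and density does the
  rest.\<close>

lemma coefficient_bound:
  obtains m where "0 < m" "\<And>x K. (\<Sum>n<K. (cmod \<langle>x, \<psi> n\<rangle>)\<^sup>2) \<le> (norm x)\<^sup>2 / m"
proof -
  obtain m M where mM: "0 < m"
    "\<And>N a. m * (\<Sum>n<N. (cmod (a n))\<^sup>2) \<le> (norm (\<Sum>n<N. a n *\<^sub>J \<phi> n))\<^sup>2"
    by (rule riesz_bounds) blast
  have "(\<Sum>n<K. (cmod \<langle>x, \<psi> n\<rangle>)\<^sup>2) \<le> (norm x)\<^sup>2 / m" for K x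
  proof (induction x rule: dense_induct)
    case closed
    have "continuous_on UNIV (\<lambda>x. \<langle>x, \<psi> n\<rangle>)" for n
      by (simp add: bounded_linear_cinner_left linear_continuous_on)
    then show ?case
      using mM(1) by (intro closed_Collect_le continuous_intros) auto
  next
    case (span N a)
    have "(\<Sum>n<K. (cmod \<langle>\<Sum>n<N. a n *\<^sub>J \<phi> n, \<psi> n\<rangle>)\<^sup>2) = (\<Sum>n\<in>{..<K} \<inter> {..<N}. (cmod (a n))\<^sup>2)"
      unfolding cinner_span by (rule sum.mono_neutral_cong_right) auto
    also have "\<dots> \<le> (\<Sum>n<N. (cmod (a n))\<^sup>2)"
      by (rule sum_mono2) auto
    also have "\<dots> \<le> (norm (\<Sum>n<N. a n *\<^sub>J \<phi> n))\<^sup>2 / m"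
      using mM by (simp add: field_simps)
    finally show ?case .
  qed
  with mM(1) that show ?thesis by blast
qed

lemma square_summable_coefficients: "square_summable (\<lambda>n. \<langle>x, \<psi> n\<rangle>)"
proof -
  obtain m where "\<And>x K. (\<Sum>n<K. (cmod \<langle>x, \<psi> n\<rangle>)\<^sup>2) \<le> (norm x)\<^sup>2 / m"
    by (rule coefficient_bound) blast
  then show ?thesis
    unfolding square_summable_def by (intro summableI_nonneg_bounded[where x = "(norm x)\<^sup>2 / m"]) auto
qed

text \<open>By the upper Riesz inequality, blocks of the series are controlled by blocks of the
  convergent series of \<open>(cmod (a n))\<^sup>2\<close>, so the partial sums are Cauchy.\<close>

lemma synthesis_sums:
  assumes "square_summable a"
  shows "(\<lambda>n. a n *\<^sub>J \<phi> n) sums synthesis a"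
proof -
  obtain M where M: "0 < M"
    "\<And>S a. finite S \<Longrightarrow> (norm (\<Sum>n\<in>S. a n *\<^sub>J \<phi> n))\<^sup>2 \<le> M * (\<Sum>n\<in>S. (cmod (a n))\<^sup>2)"
    by (rule riesz_bounds) blast
  have "Cauchy (\<lambda>N. \<Sum>n<N. a n *\<^sub>J \<phi> n)"
  proof (rule CauchyI')
    fix e :: real assume "e > 0"
    then have "e\<^sup>2 / M > 0" using M by simp
    then obtain K where K: "\<And>k l. k \<ge> K \<Longrightarrow> norm (\<Sum>n=k..<l. (cmod (a n))\<^sup>2) < e\<^sup>2 / M"
      using assms unfolding square_summable_def summable_Cauchy by blast
    have "dist (\<Sum>n<k. a n *\<^sub>J \<phi> n) (\<Sum>n<l. a n *\<^sub>J \<phi> n) < e" if "k \<ge> K" "k < l" for k l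
    proof -
      have "(\<Sum>n<l. a n *\<^sub>J \<phi> n) - (\<Sum>n<k. a n *\<^sub>J \<phi> n) = (\<Sum>n=k..<l. a n *\<^sub>J \<phi> n)"
        using sum_diff_nat_ivl[of 0 k l "\<lambda>n. a n *\<^sub>J \<phi> n"] that by (simp add: atLeast0LessThan)
      moreover have "(norm (\<Sum>n=k..<l. a n *\<^sub>J \<phi> n))\<^sup>2 < e\<^sup>2"
      proof -
        have "(norm (\<Sum>n=k..<l. a n *\<^sub>J \<phi> n))\<^sup>2 \<le> M * (\<Sum>n=k..<l. (cmod (a n))\<^sup>2)"
          by (rule M) simp
        also have "\<dots> < M * (e\<^sup>2 / M)"
          using K[OF that(1), of l] M(1) by (intro mult_strict_left_mono) (auto simp: sum_nonneg)
        finally show ?thesis using M(1) by simp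
      qed
      ultimately show ?thesis
        using \<open>e > 0\<close> by (metis dist_norm dist_commute less_imp_le power_less_imp_less_base)
    qed
    then show "\<exists>K. \<forall>k\<ge>K. \<forall>l>k. dist (\<Sum>n<k. a n *\<^sub>J \<phi> n) (\<Sum>n<l. a n *\<^sub>J \<phi> n) < e"
      by blast
  qed
  then have "convergent (\<lambda>N. \<Sum>n<N. a n *\<^sub>J \<phi> n)"
    by (simp add: Cauchy_convergent_iff)
  then show ?thesis
    unfolding synthesis_def by (simp add: summable_iff_convergent summable_sums)
qed

lemma synthesis_norm_bound:
  obtains M where "0 < M" "\<And>a. square_summable a \<Longrightarrow> (norm (synthesis a))\<^sup>2 \<le> M * (\<Sum>n. (cmod (a n))\<^sup>2)"
proof -
  obtain M where M: "0 < M"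
    "\<And>S a. finite S \<Longrightarrow> (norm (\<Sum>n\<in>S. a n *\<^sub>J \<phi> n))\<^sup>2 \<le> M * (\<Sum>n\<in>S. (cmod (a n))\<^sup>2)"
    by (rule riesz_bounds) blast
  have "(norm (synthesis a))\<^sup>2 \<le> M * (\<Sum>n. (cmod (a n))\<^sup>2)" if a: "square_summable a" for a
  proof (rule LIMSEQ_le)
    show "(\<lambda>N. (norm (\<Sum>n<N. a n *\<^sub>J \<phi> n))\<^sup>2) \<longlonglongrightarrow> (norm (synthesis a))\<^sup>2"
      using synthesis_sums[OF a] unfolding sums_def by (intro tendsto_intros)
    show "(\<lambda>N. M * (\<Sum>n<N. (cmod (a n))\<^sup>2)) \<longlonglongrightarrow> M * (\<Sum>n. (cmod (a n))\<^sup>2)"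
      using a unfolding square_summable_def by (intro tendsto_intros summable_LIMSEQ)
    show "\<exists>N. \<forall>n\<ge>N. (norm (\<Sum>n<n. a n *\<^sub>J \<phi> n))\<^sup>2 \<le> M * (\<Sum>n<n. (cmod (a n))\<^sup>2)"
      using M(2) by blast
  qed
  with M(1) that show ?thesis by blast
qed

lemma cinner_synthesis_sums:
  assumes "square_summable a"
  shows "(\<lambda>n. a n * \<langle>\<phi> n, g\<rangle>) sums \<langle>synthesis a, g\<rangle>"
  using bounded_linear.sums[OF bounded_linear_cinner_left synthesis_sums[OF assms], of g]
  by (simp add: cinner_scaleC_left)

lemma cinner_synthesis:
  assumes "square_summable a"
  shows "\<langle>synthesis a, \<psi> k\<rangle> = a k"
proof -
  have "(\<lambda>n. if n = k then a n else 0) sums \<langle>synthesis a, \<psi> k\<rangle>"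
    using cinner_synthesis_sums[OF assms, of "\<psi> k"] by (simp add: biorthogonal if_distrib cong: if_cong)
  from sums_unique2[OF this sums_single] show ?thesis .
qed

lemma square_summable_diagonal:
  "(\<And>n. cmod (d n) \<le> K) \<Longrightarrow> square_summable (\<lambda>n. d n * \<langle>x, \<psi> n\<rangle>)"
  by (rule square_summable_mult_bounded[OF _ square_summable_coefficients])

lemma cinner_diagonal: "(\<And>n. cmod (d n) \<le> K) \<Longrightarrow> \<langle>diagonal d x, \<psi> k\<rangle> = d k * \<langle>x, \<psi> k\<rangle>"
  unfolding diagonal_def by (rule cinner_synthesis[OF square_summable_diagonal])

lemma bounded_clinear_diagonal:
  assumes d: "\<And>n. cmod (d n) \<le> K"
  shows "bounded_clinear J (diagonal d)"
proof -
  have sq: "square_summable (\<lambda>n. d n * \<langle>x, \<psi> n\<rangle>)" for x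
    by (rule square_summable_diagonal[OF d])
  have sm: "(\<lambda>n. (d n * \<langle>x, \<psi> n\<rangle>) *\<^sub>J \<phi> n) sums diagonal d x" for x
    unfolding diagonal_def by (rule synthesis_sums[OF sq])
  have K: "K \<ge> 0" using d[of 0] norm_ge_zero order_trans by blast
  obtain M where M: "0 < M" "\<And>a. square_summable a \<Longrightarrow> (norm (synthesis a))\<^sup>2 \<le> M * (\<Sum>n. (cmod (a n))\<^sup>2)"
    by (rule synthesis_norm_bound) blast
  obtain m where m: "0 < m" "\<And>x K. (\<Sum>n<K. (cmod \<langle>x, \<psi> n\<rangle>)\<^sup>2) \<le> (norm x)\<^sup>2 / m"
    by (rule coefficient_bound) blast
  have "diagonal d (x + y) = diagonal d x + diagonal d y" for x y
    using sums_unique2[OF sm[where x = "x + y"] sums_add[OF sm[where x = x] sm[where x = y], unfolded scaleC_add_left[symmetric] distrib_left[symmetric] cinner_add_left[symmetric]]]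
    by simp
  moreover have "diagonal d (r *\<^sub>R x) = r *\<^sub>R diagonal d x" for r x
    using sums_unique2[OF sm[where x = "r *\<^sub>R x"], of "r *\<^sub>R diagonal d x"] sums_scaleR_right[OF sm[where x = x], of r]
    by (simp add: cinner_scaleR_left flip: scaleR_scaleC_left)
  moreover have "norm (diagonal d x) \<le> norm x * (sqrt (M / m) * K)" for x
  proof (rule power2_le_imp_le)
    have "(norm (diagonal d x))\<^sup>2 \<le> M * (\<Sum>n. (cmod (d n * \<langle>x, \<psi> n\<rangle>))\<^sup>2)"
      unfolding diagonal_def by (rule M(2)[OF sq])
    also have "(\<Sum>n. (cmod (d n * \<langle>x, \<psi> n\<rangle>))\<^sup>2) \<le> (\<Sum>n. K\<^sup>2 * (cmod \<langle>x, \<psi> n\<rangle>)\<^sup>2)"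
      using sq[of x] square_summable_coefficients[of x] power_mono[OF d norm_ge_zero, where n = 2]
      by (intro suminf_le) (auto simp: square_summable_def norm_mult power_mult_distrib mult_right_mono)
    also have "\<dots> = K\<^sup>2 * (\<Sum>n. (cmod \<langle>x, \<psi> n\<rangle>)\<^sup>2)"
      using square_summable_coefficients[of x] by (intro suminf_mult) (simp add: square_summable_def)
    also have "(\<Sum>n. (cmod \<langle>x, \<psi> n\<rangle>)\<^sup>2) \<le> (norm x)\<^sup>2 / m"
      using square_summable_coefficients[of x] m(2) by (intro suminf_le_const) (auto simp: square_summable_def)
    finally have "(norm (diagonal d x))\<^sup>2 \<le> M * (K\<^sup>2 * ((norm x)\<^sup>2 / m))"
      using M(1) by (simp add: mult_left_mono)
    also have "\<dots> = (norm x * (sqrt (M / m) * K))\<^sup>2"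
      using M(1) m(1) by (simp add: power_mult_distrib)
    finally show "(norm (diagonal d x))\<^sup>2 \<le> (norm x * (sqrt (M / m) * K))\<^sup>2" .
    show "0 \<le> norm x * (sqrt (M / m) * K)" using K M(1) m(1) by simp
  qed
  ultimately have "bounded_linear (diagonal d)"
    by (intro bounded_linear_intro) auto
  moreover have "diagonal d (J x) = J (diagonal d x)" for x
  proof -
    have "bounded_linear J"
      using linear_J by (intro bounded_linear_intro[of J 1]) auto
    from bounded_linear.sums[OF this sm[where x = x]]
    have "(\<lambda>n. (d n * \<langle>J x, \<psi> n\<rangle>) *\<^sub>J \<phi> n) sums J (diagonal d x)"
      by (simp add: cinner_J_left mult.left_commute i_scaleC)
    then show ?thesis
      by (rule sums_unique2[OF sm])
  qed
  ultimately show ?thesis by (simp add: bounded_clinear_def)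
qed

text \<open>The bounded operator \<open>diagonal (\<lambda>_. 1)\<close> fixes every finite
  combination of the basis, hence by density every vector.\<close>

lemma synthesis_coefficients: "synthesis (\<lambda>n. \<langle>x, \<psi> n\<rangle>) = x"
proof -
  have "diagonal (\<lambda>_. 1) x = x"
  proof (induction x rule: dense_induct)
    case closed
    have "bounded_linear (diagonal (\<lambda>_. 1))"
      using bounded_clinear_diagonal[of "\<lambda>_. 1" 1] by (auto simp: bounded_clinear_def)
    then show ?case
      by (intro closed_Collect_eq linear_continuous_on continuous_intros)
  next
    case (span N a)
    let ?x = "\<Sum>n<N. a n *\<^sub>J \<phi> n"
    have "(\<lambda>n. (1 * \<langle>?x, \<psi> n\<rangle>) *\<^sub>J \<phi> n) sums diagonal (\<lambda>_. 1) ?x"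
      unfolding diagonal_def by (intro synthesis_sums square_summable_diagonal[where K=1]) simp
    moreover have "(\<lambda>n. (1 * \<langle>?x, \<psi> n\<rangle>) *\<^sub>J \<phi> n) sums (\<Sum>n<N. (1 * \<langle>?x, \<psi> n\<rangle>) *\<^sub>J \<phi> n)"
      by (rule sums_finite) (auto simp: cinner_span)
    moreover have "(\<Sum>n<N. (1 * \<langle>?x, \<psi> n\<rangle>) *\<^sub>J \<phi> n) = ?x"
      by (auto simp: cinner_span)
    ultimately show ?case
      using sums_unique2 by metis
  qed
  then show ?thesis by (simp add: diagonal_def)
qed

lemma coefficients_eqI:
  assumes "\<And>n. \<langle>x, \<psi> n\<rangle> = \<langle>y, \<psi> n\<rangle>"
  shows "x = y"
proof -
  have "synthesis (\<lambda>n. \<langle>x, \<psi> n\<rangle>) = synthesis (\<lambda>n. \<langle>y, \<psi> n\<rangle>)"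
    by (simp only: assms)
  then show ?thesis
    unfolding synthesis_coefficients .
qed

lemma cinner_sums: "(\<lambda>n. \<langle>x, \<psi> n\<rangle> * \<langle>\<phi> n, g\<rangle>) sums \<langle>x, g\<rangle>"
  using cinner_synthesis_sums[OF square_summable_coefficients, of x g] by (simp add: synthesis_coefficients)

lemma square_summable_cinner_basis: "square_summable (\<lambda>n. \<langle>\<phi> n, g\<rangle>)"
proof -
  obtain M where M: "0 < M"
    "\<And>S a. finite S \<Longrightarrow> (norm (\<Sum>n\<in>S. a n *\<^sub>J \<phi> n))\<^sup>2 \<le> M * (\<Sum>n\<in>S. (cmod (a n))\<^sup>2)"
    by (rule riesz_bounds) blast
  have "(\<Sum>n<N. (cmod \<langle>\<phi> n, g\<rangle>)\<^sup>2) \<le> M * (2 * norm g)\<^sup>2" for N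
  proof -
    \<comment> \<open>Testing \<open>g\<close> against the combination \<open>?v\<close> with
      conjugated coefficients gives \<open>\<langle>?v, g\<rangle> = ?s\<close>, while the upper
      Riesz inequality bounds \<open>?v\<close> in terms of \<open>?s\<close>.\<close>
    let ?s = "\<Sum>n<N. (cmod \<langle>\<phi> n, g\<rangle>)\<^sup>2" and ?v = "\<Sum>n<N. cnj \<langle>\<phi> n, g\<rangle> *\<^sub>J \<phi> n"
    have s: "?s \<ge> 0" by (simp add: sum_nonneg)
    have "\<langle>?v, g\<rangle> = of_real ?s"
      unfolding cinner_sum_left cinner_scaleC_left of_real_sum
      by (rule sum.cong[OF refl]) (subst complex_norm_square, rule mult.commute)
    then have le: "?s \<le> 2 * norm ?v * norm g"
      using norm_cinner_le[of ?v g] s by (simp only: norm_of_real abs_of_nonneg)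
    have "(norm ?v)\<^sup>2 \<le> M * ?s"
      using M(2)[of "{..<N}" "\<lambda>n. cnj \<langle>\<phi> n, g\<rangle>", OF finite_lessThan] by (simp only: complex_mod_cnj)
    \<comment> \<open>Combining the two estimates gives
      \<open>s\<^sup>2 \<le> 4 * G\<^sup>2 * M * s\<close>; dividing by \<open>s\<close> leaves a
      bound that does not depend on the number of terms.\<close>
    moreover have "s \<le> M * (2 * G)\<^sup>2" if "s \<ge> 0" "s \<le> 2 * v * G" "v\<^sup>2 \<le> M * s" for s v G :: real
    proof (cases "s = 0")
      case False
      have "s\<^sup>2 \<le> (2 * G)\<^sup>2 * v\<^sup>2"
        using power_mono[OF that(2,1), of 2] by (simp add: power_mult_distrib mult_ac)
      also have "\<dots> \<le> (2 * G)\<^sup>2 * (M * s)"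
        using that(3) by (intro mult_left_mono) auto
      finally have "s * s \<le> (M * (2 * G)\<^sup>2) * s"
        by (simp add: power2_eq_square mult_ac)
      with False that(1) show ?thesis by (metis mult_le_cancel_right order_le_less not_less)
    qed (use M(1) in simp)
    ultimately show ?thesis using s le by blast
  qed
  then show ?thesis
    unfolding square_summable_def by (intro summableI_nonneg_bounded[where x = "M * (2 * norm g)\<^sup>2"]) auto
qed

lemma summable_cinner_products: "summable (\<lambda>n. cmod (\<langle>x, \<psi> n\<rangle> * \<langle>\<phi> n, g\<rangle>))"
  by (rule square_summable_product[OF square_summable_coefficients square_summable_cinner_basis])

text \<open>Finite sums integrate termwise. They converge uniformly on the interval because
  \<open>K\<close> bounds all multipliers at all times, so the tails are governed by those of the
  coefficients of \<open>x\<close> alone.\<close>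

lemma has_integral_diagonal:
  fixes e :: "nat \<Rightarrow> real \<Rightarrow> complex"
  assumes \<tau>: "0 \<le> \<tau>"
    and E: "\<And>n s. s \<in> {0..\<tau>} \<Longrightarrow> cmod (e n s) \<le> K"
    and int: "\<And>n. (e n has_integral \<sigma> n) {0..\<tau>}"
  shows "((\<lambda>s. diagonal (\<lambda>n. e n s) x) has_integral diagonal \<sigma> x) {0..\<tau>}"
proof (rule has_integral_uniform_limit[OF \<tau>])
  have \<sigma>: "cmod (\<sigma> n) \<le> K * \<tau>" for n
  proof -
    have "K \<ge> 0" using order_trans[OF norm_ge_zero E[of 0]] \<tau> by simp
    then show ?thesis
      using has_integral_bound[of K "e n" "\<sigma> n" 0 \<tau>] int E \<tau> by simp
  qed
  show "((\<lambda>s. \<Sum>n<N. (e n s * \<langle>x, \<psi> n\<rangle>) *\<^sub>J \<phi> n) has_integral (\<Sum>n<N. (\<sigma> n * \<langle>x, \<psi> n\<rangle>) *\<^sub>J \<phi> n)) {0..\<tau>}" for N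
  proof (rule has_integral_sum)
    fix n
    have "bounded_linear (\<lambda>c. (c * \<langle>x, \<psi> n\<rangle>) *\<^sub>J \<phi> n)"
      by (intro bounded_linear_compose[OF bounded_linear_scaleC_left] bounded_linear_mult_left)
    from has_integral_linear[OF int[of n] this]
    show "((\<lambda>s. (e n s * \<langle>x, \<psi> n\<rangle>) *\<^sub>J \<phi> n) has_integral ((\<sigma> n * \<langle>x, \<psi> n\<rangle>) *\<^sub>J \<phi> n)) {0..\<tau>}"
      by (simp add: o_def)
  qed simp
  show "(\<lambda>N. \<Sum>n<N. (\<sigma> n * \<langle>x, \<psi> n\<rangle>) *\<^sub>J \<phi> n) \<longlonglongrightarrow> diagonal \<sigma> x"
    using synthesis_sums[OF square_summable_diagonal[OF \<sigma>]] by (simp add: sums_def diagonal_def)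
  obtain M where M: "0 < M" "\<And>a. square_summable a \<Longrightarrow> (norm (synthesis a))\<^sup>2 \<le> M * (\<Sum>n. (cmod (a n))\<^sup>2)"
    by (rule synthesis_norm_bound) blast
  let ?x = "\<lambda>n. (cmod \<langle>x, \<psi> n\<rangle>)\<^sup>2"
  have sx: "summable ?x"
    using square_summable_coefficients[of x] by (simp add: square_summable_def)
  have tail: "(norm ((\<Sum>n<N. (e n s * \<langle>x, \<psi> n\<rangle>) *\<^sub>J \<phi> n) - diagonal (\<lambda>n. e n s) x))\<^sup>2
      \<le> M * (K\<^sup>2 * (\<Sum>n. ?x (n + N)))" if s: "s \<in> {0..\<tau>}" for N s
  proof -
    have sq: "square_summable (\<lambda>n. e n s * \<langle>x, \<psi> n\<rangle>)"
      by (rule square_summable_diagonal[OF E[OF s]])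
    \<comment> \<open>Dropping the first \<open>N\<close> coefficients makes
      \<open>synthesis ?a\<close> the remainder of the series, to which the upper Riesz inequality
      applies.\<close>
    let ?a = "\<lambda>n. if n < N then 0 else e n s * \<langle>x, \<psi> n\<rangle>"
    have eq: "?a = (\<lambda>n. (if n < N then 0 else 1) * (e n s * \<langle>x, \<psi> n\<rangle>))" by auto
    have sqa: "square_summable ?a"
      unfolding eq by (rule square_summable_mult_bounded[OF _ sq, where K = 1]) simp
    have "(\<lambda>n. (e n s * \<langle>x, \<psi> n\<rangle>) *\<^sub>J \<phi> n - ?a n *\<^sub>J \<phi> n) sums (diagonal (\<lambda>n. e n s) x - synthesis ?a)"
      unfolding diagonal_def by (intro sums_diff synthesis_sums sq sqa)
    moreover have "(\<lambda>n. (e n s * \<langle>x, \<psi> n\<rangle>) *\<^sub>J \<phi> n - ?a n *\<^sub>J \<phi> n) sums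
        (\<Sum>n<N. (e n s * \<langle>x, \<psi> n\<rangle>) *\<^sub>J \<phi> n - ?a n *\<^sub>J \<phi> n)"
      by (rule sums_finite) auto
    ultimately have "diagonal (\<lambda>n. e n s) x - synthesis ?a = (\<Sum>n<N. (e n s * \<langle>x, \<psi> n\<rangle>) *\<^sub>J \<phi> n - ?a n *\<^sub>J \<phi> n)"
      by (rule sums_unique2)
    also have "\<dots> = (\<Sum>n<N. (e n s * \<langle>x, \<psi> n\<rangle>) *\<^sub>J \<phi> n)"
      by (rule sum.cong) auto
    finally have eq: "(\<Sum>n<N. (e n s * \<langle>x, \<psi> n\<rangle>) *\<^sub>J \<phi> n) = diagonal (\<lambda>n. e n s) x - synthesis ?a" ..
    have "(norm ((\<Sum>n<N. (e n s * \<langle>x, \<psi> n\<rangle>) *\<^sub>J \<phi> n) - diagonal (\<lambda>n. e n s) x))\<^sup>2 = (norm (synthesis ?a))\<^sup>2"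
      unfolding eq by simp
    also have "\<dots> \<le> M * (\<Sum>n. (cmod (?a n))\<^sup>2)"
      by (rule M(2)[OF sqa])
    also have "(\<Sum>n. (cmod (?a n))\<^sup>2) = (\<Sum>n. (cmod (?a (n + N)))\<^sup>2) + (\<Sum>n<N. (cmod (?a n))\<^sup>2)"
      using sqa unfolding square_summable_def by (rule suminf_split_initial_segment)
    also have "\<dots> = (\<Sum>n. (cmod (?a (n + N)))\<^sup>2)"
      by simp
    also have "\<dots> \<le> (\<Sum>n. K\<^sup>2 * ?x (n + N))"
    proof (rule suminf_le)
      show "(cmod (?a (n + N)))\<^sup>2 \<le> K\<^sup>2 * ?x (n + N)" for n
        using power_mono[OF E[OF s, of "n + N"], of 2] by (simp add: norm_mult power_mult_distrib mult_right_mono)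
      show "summable (\<lambda>n. (cmod (?a (n + N)))\<^sup>2)"
        using sqa unfolding square_summable_def by (rule summable_ignore_initial_segment)
      show "summable (\<lambda>n. K\<^sup>2 * ?x (n + N))"
        by (intro summable_mult summable_ignore_initial_segment sx)
    qed
    also have "\<dots> = K\<^sup>2 * (\<Sum>n. ?x (n + N))"
      by (intro suminf_mult summable_ignore_initial_segment sx)
    finally show ?thesis using M(1) by simp
  qed
  show "uniform_limit {0..\<tau>} (\<lambda>N s. \<Sum>n<N. (e n s * \<langle>x, \<psi> n\<rangle>) *\<^sub>J \<phi> n) (\<lambda>s. diagonal (\<lambda>n. e n s) x) sequentially"
  proof (rule uniform_limitI)
    fix \<epsilon> :: real assume \<epsilon>: "\<epsilon> > 0"
    have "(\<lambda>N. M * (K\<^sup>2 * (\<Sum>n. ?x (n + N)))) \<longlonglongrightarrow> M * (K\<^sup>2 * 0)"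
      by (rule tendsto_mult[OF tendsto_const tendsto_mult[OF tendsto_const suminf_exist_split2[OF sx]]])
    then have "\<forall>\<^sub>F N in sequentially. M * (K\<^sup>2 * (\<Sum>n. ?x (n + N))) < \<epsilon>\<^sup>2"
      using \<epsilon> by (intro order_tendstoD(2)[where y = "M * (K\<^sup>2 * 0)"]) auto
    then show "\<forall>\<^sub>F N in sequentially. \<forall>s\<in>{0..\<tau>}. dist (\<Sum>n<N. (e n s * \<langle>x, \<psi> n\<rangle>) *\<^sub>J \<phi> n) (diagonal (\<lambda>n. e n s) x) < \<epsilon>"
    proof eventually_elim
      case (elim N)
      show ?case
      proof
        fix s assume "s \<in> {0..\<tau>}"
        from power_less_imp_less_base[OF le_less_trans[OF tail[OF this, of N] elim] less_imp_le[OF \<epsilon>]]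
        show "dist (\<Sum>n<N. (e n s * \<langle>x, \<psi> n\<rangle>) *\<^sub>J \<phi> n) (diagonal (\<lambda>n. e n s) x) < \<epsilon>"
          unfolding dist_norm .
      qed
    qed
  qed
qed

end

section \<open>Bounded semigroups\<close>

text \<open>With \<open>{0..t}\<close> cut into equal steps shorter than \<delta>, the increments
  telescope and add up to at most \<epsilon>. Uniformity of \<delta> in the base point lets forward
  increments suffice.\<close>

lemma constant_of_small_increments:
  fixes V :: "real \<Rightarrow> 'b::real_normed_vector"
  assumes small: "\<And>\<epsilon>. \<epsilon> > 0 \<Longrightarrow> \<exists>\<delta>>0. \<forall>t\<ge>0. \<forall>h. 0 < h \<and> h < \<delta> \<longrightarrow> norm (V (t + h) - V t) \<le> \<epsilon> * h"
    and t: "t \<ge> 0"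
  shows "V t = V 0"
proof (cases "t = 0")
  case False
  with t have t: "t > 0" by simp
  have "norm (V t - V 0) \<le> \<epsilon>" if \<epsilon>: "\<epsilon> > 0" for \<epsilon>
  proof -
    obtain \<delta> where \<delta>: "\<delta> > 0" "\<And>s h. s \<ge> 0 \<Longrightarrow> 0 < h \<Longrightarrow> h < \<delta> \<Longrightarrow> norm (V (s + h) - V s) \<le> \<epsilon> / t * h"
      using small[of "\<epsilon> / t"] \<epsilon> t by auto
    obtain n where n: "t / \<delta> < real n" using reals_Archimedean2 by blast
    then have n0: "0 < real n" using t \<delta>(1) by (meson divide_pos_pos less_trans)
    let ?h = "t / real n"
    have h: "0 < ?h" "?h < \<delta>" using n n0 t \<delta>(1) by (auto simp: field_simps)
    have "norm (V t - V 0) = norm (\<Sum>k<n. V (real (Suc k) * ?h) - V (real k * ?h))"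
      using sum_lessThan_telescope[of "\<lambda>k. V (real k * ?h)" n] n0 by simp
    also have "\<dots> \<le> (\<Sum>k<n. norm (V (real (Suc k) * ?h) - V (real k * ?h)))"
      by (rule norm_sum)
    also have "\<dots> \<le> (\<Sum>k<n. \<epsilon> / t * ?h)"
    proof (rule sum_mono)
      fix k
      have "real (Suc k) * ?h = real k * ?h + ?h" by (simp add: algebra_simps add_divide_distrib)
      then show "norm (V (real (Suc k) * ?h) - V (real k * ?h)) \<le> \<epsilon> / t * ?h"
        using \<delta>(2)[of "real k * ?h" ?h] h t by (simp only: mult_nonneg_nonneg of_nat_0_le_iff less_imp_le)
    qed
    also have "\<dots> = \<epsilon>" using n0 t by simp
    finally show ?thesis .
  qed
  then have "norm (V t - V 0) \<le> 0" by (rule field_le_epsilon) simp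
  then show ?thesis by simp
qed simp

context complex_hilbert
begin

text \<open>Formally \<open>y t = \<langle>U t x, g\<rangle>\<close> solves
  \<open>y' = s * y\<close>. Since the generator is given by a right derivative at 0, the forward
  increments of \<open>exp (- s * t) * y t\<close> are shown to be \<open>o(h)\<close> uniformly in
  \<open>t\<close>.\<close>

lemma orbit_exponential:
  assumes U: "c0_semigroup J U" and gen: "is_generator U D G"
    and bd: "\<And>t x. t \<ge> 0 \<Longrightarrow> norm (U t x) \<le> M * norm x"
    and x: "x \<in> D" and s: "Re s \<ge> 0" and t: "t \<ge> 0"
    and orbit: "\<And>r. r \<ge> 0 \<Longrightarrow> \<langle>U r (G x), g\<rangle> = s * \<langle>U r x, g\<rangle>"
  shows "\<langle>U t x, g\<rangle> = exp (s * t) * \<langle>x, g\<rangle>"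
proof -
  define V where "V t = exp (- (s * of_real t)) * \<langle>U t x, g\<rangle>" for t
  have "V t = V 0"
  proof (rule constant_of_small_increments[OF _ t])
    fix \<epsilon> :: real assume \<epsilon>: "\<epsilon> > 0"
    \<comment> \<open>\<open>\<rho>\<close> is the remainder of the generator's difference quotient
      and \<open>\<kappa>\<close> that of \<open>exp (- s * h) * (1 + h * s)\<close>, whose
      derivative at 0 vanishes; \<open>C\<close> bounds \<open>\<langle>U t x, g\<rangle>\<close>
      uniformly in time.\<close>
    define \<rho> where "\<rho> h = inverse h *\<^sub>R (U h x - x) - G x" for h
    define \<kappa> where "\<kappa> h = (exp (- (s * of_real h)) * (1 + of_real h * s) - 1) / of_real h" for h
    define C where "C = 2 * (M * norm x) * norm g"
    have \<rho>: "(\<rho> \<longlongrightarrow> 0) (at_right 0)"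
      using gen x unfolding is_generator_def \<rho>_def by (intro LIM_zero) blast
    have \<kappa>: "(\<kappa> \<longlongrightarrow> 0) (at_right 0)"
    proof -
      have "((\<lambda>w. exp (- (s * w)) * (1 + w * s)) has_field_derivative 0) (at 0)"
        by (auto intro!: derivative_eq_intros)
      then have "((\<lambda>w. (exp (- (s * w)) * (1 + w * s) - 1) / w) \<longlongrightarrow> 0) (at 0)"
        by (simp add: has_field_derivative_iff)
      moreover have "filterlim complex_of_real (at 0) (at_right 0)"
        unfolding filterlim_at by (auto simp: eventually_at_filter intro!: tendsto_eq_intros)
      ultimately show ?thesis
        unfolding \<kappa>_def by (rule filterlim_compose)
    qed
    have "((\<lambda>h. C * cmod (\<kappa> h) + 2 * (M * norm (\<rho> h)) * norm g) \<longlongrightarrow> C * 0 + 2 * (M * 0) * norm g) (at_right 0)"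
      by (intro tendsto_intros tendsto_norm_zero \<rho> \<kappa>)
    then have "\<forall>\<^sub>F h in at_right 0. C * cmod (\<kappa> h) + 2 * (M * norm (\<rho> h)) * norm g < \<epsilon>"
      by (rule order_tendstoD) (use \<epsilon> in simp)
    then obtain \<delta> where \<delta>: "\<delta> > 0" "\<And>h. 0 < h \<Longrightarrow> h < \<delta> \<Longrightarrow> C * cmod (\<kappa> h) + 2 * (M * norm (\<rho> h)) * norm g < \<epsilon>"
      unfolding eventually_at_right_field by auto
    have "norm (V (t + h) - V t) \<le> \<epsilon> * h" if t: "t \<ge> 0" and h: "0 < h" "h < \<delta>" for t h
    proof -
      have lin: "linear (U t)"
        using U t by (auto simp: c0_semigroup_def bounded_clinear_def bounded_linear.linear)
      have "U h x = x + h *\<^sub>R G x + h *\<^sub>R \<rho> h"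
        using h by (simp add: \<rho>_def algebra_simps)
      moreover have "U (t + h) x = U t (U h x)"
        using U t h by (simp add: c0_semigroup_def)
      ultimately have "U (t + h) x = U t x + h *\<^sub>R U t (G x) + h *\<^sub>R U t (\<rho> h)"
        by (simp add: linear_add[OF lin] linear_scale[OF lin])
      then have step: "\<langle>U (t + h) x, g\<rangle> = (1 + of_real h * s) * \<langle>U t x, g\<rangle> + of_real h * \<langle>U t (\<rho> h), g\<rangle>"
        by (simp add: cinner_add_left cinner_scaleR_left orbit[OF t] scaleR_conv_of_real algebra_simps)
      have \<kappa>': "exp (- (s * of_real h)) * (1 + of_real h * s) = 1 + of_real h * \<kappa> h"
        using h by (simp add: \<kappa>_def)
      have "V (t + h) - V t = exp (- (s * of_real t)) *
          (exp (- (s * of_real h)) * \<langle>U (t + h) x, g\<rangle> - \<langle>U t x, g\<rangle>)"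
        by (simp add: V_def algebra_simps exp_diff exp_minus divide_inverse)
      also have "exp (- (s * of_real h)) * \<langle>U (t + h) x, g\<rangle> - \<langle>U t x, g\<rangle> =
          (exp (- (s * of_real h)) * (1 + of_real h * s)) * \<langle>U t x, g\<rangle> - \<langle>U t x, g\<rangle>
          + of_real h * exp (- (s * of_real h)) * \<langle>U t (\<rho> h), g\<rangle>"
        unfolding step by (simp add: algebra_simps)
      also have "\<dots> = of_real h * (\<kappa> h * \<langle>U t x, g\<rangle> + exp (- (s * of_real h)) * \<langle>U t (\<rho> h), g\<rangle>)"
        unfolding \<kappa>' by (simp add: algebra_simps)
      finally have "norm (V (t + h) - V t) = exp (- (Re s * t)) *
          (h * cmod (\<kappa> h * \<langle>U t x, g\<rangle> + exp (- (s * of_real h)) * \<langle>U t (\<rho> h), g\<rangle>))"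
        using h by (simp add: norm_mult)
      \<comment> \<open>As \<open>Re s \<ge> 0\<close>, the exponential factors are at most 1, which
        makes the estimate independent of \<open>t\<close>.\<close>
      also have "\<dots> \<le> 1 * (h * cmod (\<kappa> h * \<langle>U t x, g\<rangle> + exp (- (s * of_real h)) * \<langle>U t (\<rho> h), g\<rangle>))"
        using h s t by (intro mult_right_mono) auto
      also have "cmod (\<kappa> h * \<langle>U t x, g\<rangle> + exp (- (s * of_real h)) * \<langle>U t (\<rho> h), g\<rangle>) \<le>
          cmod (\<kappa> h) * cmod \<langle>U t x, g\<rangle> + exp (- (Re s * h)) * cmod \<langle>U t (\<rho> h), g\<rangle>"
        by (rule order_trans[OF norm_triangle_ineq]) (simp add: norm_mult)
      also have "exp (- (Re s * h)) * cmod \<langle>U t (\<rho> h), g\<rangle> \<le> 1 * cmod \<langle>U t (\<rho> h), g\<rangle>"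
        using h s by (intro mult_right_mono) auto
      also have "cmod \<langle>U t (\<rho> h), g\<rangle> \<le> 2 * (M * norm (\<rho> h)) * norm g"
        by (rule order_trans[OF norm_cinner_le]) (intro mult_right_mono mult_left_mono bd[OF t]; simp)
      also have "cmod (\<kappa> h) * cmod \<langle>U t x, g\<rangle> \<le> cmod (\<kappa> h) * C"
        unfolding C_def
        by (rule mult_left_mono[OF order_trans[OF norm_cinner_le] norm_ge_zero]) (intro mult_right_mono mult_left_mono bd[OF t]; simp)
      also have "cmod (\<kappa> h) * C + 1 * (2 * (M * norm (\<rho> h)) * norm g) \<le> \<epsilon>"
        using \<delta>(2)[OF h] by (simp add: mult.commute)
      finally show ?thesis using h by (simp add: mult.commute mult_right_mono)
    qed
    with \<delta>(1) show "\<exists>\<delta>>0. \<forall>t\<ge>0. \<forall>h. 0 < h \<and> h < \<delta> \<longrightarrow> norm (V (t + h) - V t) \<le> \<epsilon> * h"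
      by blast
  qed
  moreover have "U 0 x = x" using U by (simp add: c0_semigroup_def)
  ultimately have "exp (- (s * of_real t)) * \<langle>U t x, g\<rangle> = \<langle>x, g\<rangle>"
    by (simp add: V_def)
  then show ?thesis
    by (simp add: exp_minus field_simps)
qed

text \<open>A nonzero \<open>\<langle>x, g\<rangle>\<close> would make
  \<open>\<langle>U t x, g\<rangle>\<close> grow like \<open>exp (Re s * t)\<close>, against
  boundedness. Working with a functional \<open>g\<close> covers eigenvectors of the generator and
  of its adjoint alike.\<close>

lemma bounded_semigroup_unstable_orbit:
  assumes U: "c0_semigroup J U" and gen: "is_generator U D G"
    and bd: "\<And>t x. t \<ge> 0 \<Longrightarrow> norm (U t x) \<le> M * norm x"
    and x: "x \<in> D" and s: "Re s > 0"
    and orbit: "\<And>r. r \<ge> 0 \<Longrightarrow> \<langle>U r (G x), g\<rangle> = s * \<langle>U r x, g\<rangle>"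
  shows "\<langle>x, g\<rangle> = 0"
proof (rule ccontr)
  assume nz: "\<langle>x, g\<rangle> \<noteq> 0"
  define C where "C = 2 * (M * norm x) * norm g"
  have C: "exp (Re s * t) * cmod \<langle>x, g\<rangle> \<le> C" if t: "t \<ge> 0" for t
  proof -
    have "exp (Re s * t) * cmod \<langle>x, g\<rangle> = cmod \<langle>U t x, g\<rangle>"
      using orbit_exponential[OF U gen bd x _ t orbit] s by (simp add: norm_mult)
    also have "\<dots> \<le> C"
      unfolding C_def by (rule order_trans[OF norm_cinner_le]) (intro mult_right_mono mult_left_mono bd[OF t]; simp)
    finally show ?thesis .
  qed
  have "C \<ge> 0" using order_trans[OF _ C[of 0]] by simp
  \<comment> \<open>At this time \<open>Re s * t * cmod \<langle>x, g\<rangle>\<close> equals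
    \<open>C\<close>, so \<open>1 + u \<le> exp u\<close> pushes the orbit strictly beyond
    \<open>C\<close>.\<close>
  define t where "t = C / (cmod \<langle>x, g\<rangle> * Re s)"
  have t: "t \<ge> 0" "Re s * t * cmod \<langle>x, g\<rangle> = C"
    using \<open>C \<ge> 0\<close> s nz by (auto simp: t_def)
  have "(1 + Re s * t) * cmod \<langle>x, g\<rangle> \<le> exp (Re s * t) * cmod \<langle>x, g\<rangle>"
    by (intro mult_right_mono exp_ge_add_one_self) simp
  moreover have "cmod \<langle>x, g\<rangle> > 0" using nz by simp
  ultimately show False using C[OF t(1)] t(2) by (simp only: distrib_right)
qed

lemma bounded_semigroup_no_unstable_eigenvector:
  assumes U: "c0_semigroup J U" and gen: "is_generator U D G"
    and bd: "\<And>t x. t \<ge> 0 \<Longrightarrow> norm (U t x) \<le> M * norm x"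
    and x: "x \<in> D" and s: "Re s > 0" and eig: "G x = s *\<^sub>J x"
  shows "x = 0"
proof -
  have "\<langle>U r (G x), x\<rangle> = s * \<langle>U r x, x\<rangle>" if "r \<ge> 0" for r
    using U that bounded_clinear_scaleC[of "U r"] by (simp add: eig cinner_scaleC_left c0_semigroup_def)
  from bounded_semigroup_unstable_orbit[OF U gen bd x s this] show ?thesis
    by (simp add: cinner_self)
qed

text \<open>Here \<open>g\<close> is an eigenvector of the adjoint in weak form. The domain is
  invariant under \<open>U r\<close>, and \<open>G\<close> commutes with \<open>U r\<close> on it,
  so the eigenvector relation holds along the whole orbit.\<close>

lemma bounded_semigroup_no_unstable_coeigenvector:
  assumes U: "c0_semigroup J U" and gen: "is_generator U D G"
    and bd: "\<And>t x. t \<ge> 0 \<Longrightarrow> norm (U t x) \<le> M * norm x"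
    and x: "x \<in> D" and s: "Re s > 0" and eig: "\<And>x. x \<in> D \<Longrightarrow> \<langle>G x, g\<rangle> = s * \<langle>x, g\<rangle>"
  shows "\<langle>x, g\<rangle> = 0"
proof (rule bounded_semigroup_unstable_orbit[OF U gen bd x s])
  fix r :: real assume r: "r \<ge> 0"
  have bl: "bounded_linear (U r)"
    using U r by (auto simp: c0_semigroup_def bounded_clinear_def)
  have "((\<lambda>h. U r (inverse h *\<^sub>R (U h x - x))) \<longlongrightarrow> U r (G x)) (at_right 0)"
    using gen x by (intro bounded_linear.tendsto[OF bl]) (auto simp: is_generator_def)
  moreover have "\<forall>\<^sub>F h in at_right 0. U r (inverse h *\<^sub>R (U h x - x)) = inverse h *\<^sub>R (U h (U r x) - U r x)"
  proof -
    have "U r (inverse h *\<^sub>R (U h x - x)) = inverse h *\<^sub>R (U h (U r x) - U r x)" if "h > 0" for h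
    proof -
      have "U r (U h x) = U (r + h) x" "U h (U r x) = U (h + r) x"
        using U r that unfolding c0_semigroup_def by (metis comp_apply less_imp_le)+
      then show ?thesis
        by (simp add: bounded_linear.linear[OF bl] linear_scale linear_diff add.commute)
    qed
    then show ?thesis
      by (auto simp: eventually_at_filter)
  qed
  ultimately have lim: "((\<lambda>h. inverse h *\<^sub>R (U h (U r x) - U r x)) \<longlongrightarrow> U r (G x)) (at_right 0)"
    by (rule Lim_transform_eventually)
  then have D: "U r x \<in> D"
    using gen by (auto simp: is_generator_def)
  then have "((\<lambda>h. inverse h *\<^sub>R (U h (U r x) - U r x)) \<longlongrightarrow> G (U r x)) (at_right 0)"
    using gen by (simp add: is_generator_def)
  then have "G (U r x) = U r (G x)"
    by (rule tendsto_unique[OF trivial_limit_at_right_real _ lim])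
  then show "\<langle>U r (G x), g\<rangle> = s * \<langle>U r x, g\<rangle>"
    using eig[OF D] by simp
qed

end

section \<open>Resolvents of rank-one perturbations of diagonal operators\<close>

context riesz_system
begin

text \<open>Sherman-Morrison: with \<open>d n = 1 / (z - e n)\<close> the perturbed resolvent is
  \<open>diagonal d\<close> plus a rank-one term whose denominator \<open>1 - q\<close> is nonzero
  by the last hypothesis.\<close>

lemma resolvent_rank_one_regular:
  assumes e: "\<And>n. cmod (e n) \<le> K" and z: "\<And>n. z \<noteq> e n"
    and d: "\<And>n. cmod (1 / (z - e n)) \<le> K'"
    and ne: "\<langle>diagonal (\<lambda>n. 1 / (z - e n)) v, f\<rangle> \<noteq> 1"
  shows "z \<in> bounded_resolvent_set J (\<lambda>x. diagonal e x + \<langle>x, f\<rangle> *\<^sub>J v)"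
proof -
  define d where "d n = 1 / (z - e n)" for n
  define q where "q = \<langle>diagonal d v, f\<rangle>"
  define R where "R y = diagonal d y + (1 / (1 - q) * \<langle>diagonal d y, f\<rangle>) *\<^sub>J diagonal d v" for y
  have d: "\<And>n. cmod (d n) \<le> K'" using d by (simp add: d_def)
  have dz: "(z - e n) * d n = 1" for n using z[of n] by (simp add: d_def)
  have q: "q \<noteq> 1" using ne by (simp add: q_def d_def[abs_def])
  note [simp] = cinner_diagonal[OF e] cinner_diagonal[OF d] cinner_add_left cinner_diff_left cinner_scaleC_left
  have Rf: "\<langle>R y, f\<rangle> = 1 / (1 - q) * \<langle>diagonal d y, f\<rangle>" for y
    using q by (simp add: R_def flip: q_def) (simp add: field_simps)
  have "z *\<^sub>J R y - (diagonal e (R y) + \<langle>R y, f\<rangle> *\<^sub>J v) = y" for y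
  proof (rule coefficients_eqI)
    fix n
    have "\<langle>z *\<^sub>J R y - (diagonal e (R y) + \<langle>R y, f\<rangle> *\<^sub>J v), \<psi> n\<rangle> =
      ((z - e n) * d n) * \<langle>y, \<psi> n\<rangle> + ((z - e n) * d n) * \<langle>R y, f\<rangle> * \<langle>v, \<psi> n\<rangle> - \<langle>R y, f\<rangle> * \<langle>v, \<psi> n\<rangle>"
      unfolding Rf by (simp add: R_def algebra_simps diff_divide_distrib)
    then show "\<langle>z *\<^sub>J R y - (diagonal e (R y) + \<langle>R y, f\<rangle> *\<^sub>J v), \<psi> n\<rangle> = \<langle>y, \<psi> n\<rangle>"
      unfolding dz by simp
  qed
  moreover have "R (z *\<^sub>J x - (diagonal e x + \<langle>x, f\<rangle> *\<^sub>J v)) = x" for x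
  proof -
    have D: "diagonal d (z *\<^sub>J x - (diagonal e x + \<langle>x, f\<rangle> *\<^sub>J v)) = x - \<langle>x, f\<rangle> *\<^sub>J diagonal d v"
    proof (rule coefficients_eqI)
      fix n
      have "\<langle>diagonal d (z *\<^sub>J x - (diagonal e x + \<langle>x, f\<rangle> *\<^sub>J v)), \<psi> n\<rangle> =
        ((z - e n) * d n) * \<langle>x, \<psi> n\<rangle> - \<langle>x, f\<rangle> * (d n * \<langle>v, \<psi> n\<rangle>)"
        by (simp add: algebra_simps)
      then show "\<langle>diagonal d (z *\<^sub>J x - (diagonal e x + \<langle>x, f\<rangle> *\<^sub>J v)), \<psi> n\<rangle> = \<langle>x - \<langle>x, f\<rangle> *\<^sub>J diagonal d v, \<psi> n\<rangle>"
        unfolding dz by simp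
    qed
    have "1 / (1 - q) * \<langle>x - \<langle>x, f\<rangle> *\<^sub>J diagonal d v, f\<rangle> = \<langle>x, f\<rangle>"
      using q by (simp flip: q_def) (simp add: field_simps)
    then show ?thesis unfolding R_def D by simp
  qed
  moreover have "bounded_clinear J R"
    unfolding R_def by (intro bounded_clinear_add bounded_clinear_rank_one bounded_clinear_diagonal[OF d])
  ultimately show ?thesis unfolding bounded_resolvent_set_def by blast
qed

text \<open>Although \<open>z\<close> is an eigenvalue of the diagonal part, the perturbation
  removes it when it both excites and observes mode \<open>m\<close>: component \<open>m\<close> of
  the equation fixes \<open>\<langle>R y, f\<rangle>\<close>, and the part of \<open>R y\<close>
  along \<open>\<phi> m\<close> is then adjusted to attain that value.\<close>

lemma resolvent_rank_one_singular:
  assumes e: "\<And>n. cmod (e n) \<le> K" and z: "z = e m" "\<And>n. n \<noteq> m \<Longrightarrow> z \<noteq> e n"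
    and d: "\<And>n. cmod (1 / (z - e n)) \<le> K'"
    and v: "\<langle>v, \<psi> m\<rangle> \<noteq> 0" and f: "\<langle>\<phi> m, f\<rangle> \<noteq> 0"
  shows "z \<in> bounded_resolvent_set J (\<lambda>x. diagonal e x + \<langle>x, f\<rangle> *\<^sub>J v)"
proof -
  \<comment> \<open>\<open>d m = 0\<close> because of \<open>1 / 0 = 0\<close>, so \<open>diagonal d\<close> inverts \<open>z - T\<close> off the span of \<open>\<phi> m\<close>.\<close>
  define d where "d n = 1 / (z - e n)" for n
  \<comment> \<open>\<open>w\<close> solves \<open>(z - diagonal e) w = v\<close> off mode
    \<open>m\<close>, and its multiple of \<open>\<phi> m\<close> is chosen so that
    \<open>\<langle>w, f\<rangle> = 1\<close>.\<close>
  define w where "w = diagonal d v + ((1 - \<langle>diagonal d v, f\<rangle>) / \<langle>\<phi> m, f\<rangle>) *\<^sub>J \<phi> m"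
  define R where "R y = diagonal d y + (- 1 / \<langle>v, \<psi> m\<rangle> * \<langle>y, \<psi> m\<rangle>) *\<^sub>J w
    + (- 1 / \<langle>\<phi> m, f\<rangle> * \<langle>diagonal d y, f\<rangle>) *\<^sub>J \<phi> m" for y
  have d: "\<And>n. cmod (d n) \<le> K'" using d by (simp add: d_def)
  have dz: "(z - e n) * d n = (if n = m then 0 else 1)" for n
    using z(1) z(2)[of n] by (auto simp: d_def)
  note [simp] = cinner_diagonal[OF e] cinner_diagonal[OF d] cinner_add_left cinner_diff_left cinner_scaleC_left
  have wf: "\<langle>w, f\<rangle> = 1" using f by (simp add: w_def)
  have Rf: "\<langle>R y, f\<rangle> = - 1 / \<langle>v, \<psi> m\<rangle> * \<langle>y, \<psi> m\<rangle>" for y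
    using f by (simp add: R_def wf)
  have zw: "(z - e n) * \<langle>w, \<psi> n\<rangle> = (if n = m then 0 else \<langle>v, \<psi> n\<rangle>)" for n
    using dz[of n] z(1) by (auto simp: w_def biorthogonal mult.assoc[symmetric])
  have "z *\<^sub>J R y - (diagonal e (R y) + \<langle>R y, f\<rangle> *\<^sub>J v) = y" for y
  proof (rule coefficients_eqI)
    fix n
    have "\<langle>z *\<^sub>J R y - (diagonal e (R y) + \<langle>R y, f\<rangle> *\<^sub>J v), \<psi> n\<rangle> =
        (z - e n) * \<langle>R y, \<psi> n\<rangle> - \<langle>R y, f\<rangle> * \<langle>v, \<psi> n\<rangle>"
      by (simp add: algebra_simps)
    also have "(z - e n) * \<langle>R y, \<psi> n\<rangle> = ((z - e n) * d n) * \<langle>y, \<psi> n\<rangle> + \<langle>R y, f\<rangle> * ((z - e n) * \<langle>w, \<psi> n\<rangle>)"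
      unfolding Rf using z(1) by (auto simp: R_def biorthogonal algebra_simps diff_divide_distrib)
    also have "\<dots> - \<langle>R y, f\<rangle> * \<langle>v, \<psi> n\<rangle> = \<langle>y, \<psi> n\<rangle>"
      unfolding dz zw Rf using v by auto
    finally show "\<langle>z *\<^sub>J R y - (diagonal e (R y) + \<langle>R y, f\<rangle> *\<^sub>J v), \<psi> n\<rangle> = \<langle>y, \<psi> n\<rangle>" .
  qed
  moreover have "R (z *\<^sub>J x - (diagonal e x + \<langle>x, f\<rangle> *\<^sub>J v)) = x" for x
  proof -
    let ?y = "z *\<^sub>J x - (diagonal e x + \<langle>x, f\<rangle> *\<^sub>J v)"
    have D: "diagonal d ?y = x - \<langle>x, \<psi> m\<rangle> *\<^sub>J \<phi> m - \<langle>x, f\<rangle> *\<^sub>J diagonal d v"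
    proof (rule coefficients_eqI)
      fix n
      have "\<langle>diagonal d ?y, \<psi> n\<rangle> = ((z - e n) * d n) * \<langle>x, \<psi> n\<rangle> - \<langle>x, f\<rangle> * (d n * \<langle>v, \<psi> n\<rangle>)"
        by (simp add: algebra_simps)
      then show "\<langle>diagonal d ?y, \<psi> n\<rangle> = \<langle>x - \<langle>x, \<psi> m\<rangle> *\<^sub>J \<phi> m - \<langle>x, f\<rangle> *\<^sub>J diagonal d v, \<psi> n\<rangle>"
        unfolding dz by (auto simp: biorthogonal)
    qed
    have k: "- 1 / \<langle>v, \<psi> m\<rangle> * \<langle>?y, \<psi> m\<rangle> = \<langle>x, f\<rangle>"
      using v z(1) by simp
    have l: "- 1 / \<langle>\<phi> m, f\<rangle> * \<langle>x - \<langle>x, \<psi> m\<rangle> *\<^sub>J \<phi> m - \<langle>x, f\<rangle> *\<^sub>J diagonal d v, f\<rangle> =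
        \<langle>x, \<psi> m\<rangle> - \<langle>x, f\<rangle> * ((1 - \<langle>diagonal d v, f\<rangle>) / \<langle>\<phi> m, f\<rangle>)"
      using f by (simp add: field_simps)
    show ?thesis
      unfolding R_def k D l w_def
      by (simp add: scaleC_add_right scaleC_diff_left scaleC_scaleC)
  qed
  moreover have "bounded_clinear J R"
    unfolding R_def
    by (intro bounded_clinear_add bounded_clinear_rank_one bounded_clinear_diagonal[OF d] bounded_clinear_id)
  ultimately show ?thesis unfolding bounded_resolvent_set_def by blast
qed

end

section \<open>The sampled-data system\<close>

text \<open>\<omega> and \<Upsilon> are fixed witnesses of (A1); \<open>smooth\<close> is the common
  consequence of the two alternatives in (A4).\<close>

locale sampled_system = riesz_system J \<phi> \<psi>
  for J :: "'a::{real_inner,complete_space} \<Rightarrow> 'a" and \<phi> \<psi> :: "nat \<Rightarrow> 'a" +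
  fixes lam :: "nat \<Rightarrow> complex" and b f :: 'a and \<alpha> \<omega> \<Upsilon> :: real
  assumes inj_lam: "inj lam" and positive: "\<alpha> > 0" "\<omega> > 0" "\<Upsilon> > 0"
    and finite_exceptional: "finite {n. Re (lam n) > - \<omega> \<and> lam n \<notin> Omega_set \<alpha> \<Upsilon>}"
    and closed_loop: "generates_poly_stable J (rs_dom J lam \<psi>)
               (\<lambda>x. rs_op J lam \<phi> \<psi> x + scaleC J (cinner J x f) b) \<alpha>"
    and smooth: "\<exists>\<beta> \<gamma>. \<beta> \<ge> 0 \<and> \<gamma> \<ge> 0 \<and> b \<in> D_beta J lam \<psi> \<beta> \<and> f \<in> D_gamma_star J lam \<phi> \<gamma> \<and> \<beta> + \<gamma> \<ge> \<alpha>"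
begin

definition exceptional where "exceptional = {n. Re (lam n) > - \<omega> \<and> lam n \<notin> Omega_set \<alpha> \<Upsilon>}"

text \<open>These are the residues of the transfer function: \<open>F (p - A)^-1 B\<close> is the
  sum of \<open>coupling n / (p - lam n)\<close>.\<close>

definition coupling where "coupling n = \<langle>b, \<psi> n\<rangle> * \<langle>\<phi> n, f\<rangle>"

abbreviation "D \<equiv> rs_dom J lam \<psi>"
abbreviation "A \<equiv> rs_op J lam \<phi> \<psi>"

lemma finite_exceptional_set: "finite exceptional"
  using finite_exceptional by (simp add: exceptional_def)

lemma spectral_gap:
  assumes "n \<notin> exceptional"
  shows "\<omega> \<le> - Re (lam n) \<or> (Im (lam n) \<noteq> 0 \<and> \<Upsilon> \<le> - Re (lam n) * \<bar>Im (lam n)\<bar> powr \<alpha>)"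
proof (cases "Re (lam n) > - \<omega>")
  case True
  with assms have "Im (lam n) \<noteq> 0" "Re (lam n) \<le> - \<Upsilon> / \<bar>Im (lam n)\<bar> powr \<alpha>"
    by (auto simp: exceptional_def Omega_set_def)
  then show ?thesis by (simp add: field_simps)
qed auto

lemma Re_neg:
  assumes "n \<notin> exceptional"
  shows "Re (lam n) < 0"
proof (rule ccontr)
  assume "\<not> Re (lam n) < 0"
  then have "- Re (lam n) * \<bar>Im (lam n)\<bar> powr \<alpha> \<le> 0" "- Re (lam n) \<le> 0"
    by (simp_all add: mult_nonneg_nonneg)
  with spectral_gap[OF assms] positive show False by linarith
qed

lemma Re_bounded: obtains K where "K \<ge> 0" "\<And>n. Re (lam n) \<le> K"
proof
  show "(\<Sum>n\<in>exceptional. \<bar>Re (lam n)\<bar>) \<ge> 0" by (simp add: sum_nonneg)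
  show "Re (lam n) \<le> (\<Sum>n\<in>exceptional. \<bar>Re (lam n)\<bar>)" for n
  proof (cases "n \<in> exceptional")
    case True
    then have "\<bar>Re (lam n)\<bar> \<le> (\<Sum>n\<in>exceptional. \<bar>Re (lam n)\<bar>)"
      using finite_exceptional_set by (intro member_le_sum) auto
    then show ?thesis by linarith
  next
    case False
    then show ?thesis
      using Re_neg[OF False] sum_nonneg[of exceptional "\<lambda>n. \<bar>Re (lam n)\<bar>"] by linarith
  qed
qed

lemma bounded_off_exceptional:
  fixes d :: "nat \<Rightarrow> complex"
  assumes "\<And>n. n \<notin> exceptional \<Longrightarrow> cmod (d n) \<le> K" "K \<ge> 0"
  shows "cmod (d n) \<le> K + (\<Sum>n\<in>exceptional. cmod (d n))"
proof (cases "n \<in> exceptional")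
  case True
  then have "cmod (d n) \<le> (\<Sum>n\<in>exceptional. cmod (d n))"
    using finite_exceptional_set by (intro member_le_sum) auto
  with assms(2) show ?thesis by linarith
next
  case False
  have "(\<Sum>n\<in>exceptional. cmod (d n)) \<ge> 0" by (simp add: sum_nonneg)
  with assms(1)[OF False] show ?thesis by linarith
qed

section \<open>Closed-loop generator and its unstable modes\<close>

lemma square_summable_rs_dom: "x \<in> D \<longleftrightarrow> square_summable (\<lambda>n. lam n * \<langle>x, \<psi> n\<rangle>)"
  by (simp add: rs_dom_def square_summable_def norm_mult power_mult_distrib)

lemma cinner_rs_op: "x \<in> D \<Longrightarrow> \<langle>A x, \<psi> n\<rangle> = lam n * \<langle>x, \<psi> n\<rangle>"
  using cinner_synthesis[of "\<lambda>n. lam n * \<langle>x, \<psi> n\<rangle>" n]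
  by (simp add: square_summable_rs_dom rs_op_def synthesis_def)

lemma basis_in_rs_dom: "\<phi> m \<in> D"
  unfolding square_summable_rs_dom square_summable_def
  by (rule summable_finite[of "{m}"]) (auto simp: biorthogonal)

text \<open>On the imaginary axis the closed-loop resolvent recovers \<open>x\<close> as the image
  of 0; in the open half-plane a nonzero eigenvector would have an unbounded orbit.\<close>

lemma no_unstable_eigenvector:
  assumes s: "Re s \<ge> 0" and x: "x \<in> D" and eig: "A x + \<langle>x, f\<rangle> *\<^sub>J b = s *\<^sub>J x"
  shows "x = 0"
proof (cases "Re s = 0")
  case True
  then have "\<i> * complex_of_real (Im s) = s" by (simp add: complex_eq_iff)
  then have "s \<in> op_resolvent_set J D (\<lambda>x. A x + \<langle>x, f\<rangle> *\<^sub>J b)"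
    using closed_loop unfolding generates_poly_stable_def by metis
  then obtain R where "bounded_clinear J R" "R (s *\<^sub>J x - (A x + \<langle>x, f\<rangle> *\<^sub>J b)) = x"
    using x unfolding op_resolvent_set_def by blast
  then show ?thesis
    using linear_0[of R] by (simp add: eig bounded_clinear_def bounded_linear.linear)
next
  case False
  with s have "Re s > 0" by simp
  obtain U M where "c0_semigroup J U" "is_generator U D (\<lambda>x. A x + \<langle>x, f\<rangle> *\<^sub>J b)"
    "\<And>t x. t \<ge> 0 \<Longrightarrow> norm (U t x) \<le> M * norm x"
    using closed_loop unfolding generates_poly_stable_def by blast
  from bounded_semigroup_no_unstable_eigenvector[OF this x \<open>Re s > 0\<close> eig]
  show ?thesis by blast
qed

text \<open>Dual to the eigenvector case: on the axis the right inverse counts, since pairing the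
  resolvent identity for \<open>R x\<close> with \<open>g\<close> annihilates the side containing
  \<open>R x\<close>.\<close>

lemma no_unstable_coeigenvector:
  assumes s: "Re s \<ge> 0" and x: "x \<in> D"
    and eig: "\<And>x. x \<in> D \<Longrightarrow> \<langle>A x + \<langle>x, f\<rangle> *\<^sub>J b, g\<rangle> = s * \<langle>x, g\<rangle>"
  shows "\<langle>x, g\<rangle> = 0"
proof (cases "Re s = 0")
  case True
  then have "\<i> * complex_of_real (Im s) = s" by (simp add: complex_eq_iff)
  then have "s \<in> op_resolvent_set J D (\<lambda>x. A x + \<langle>x, f\<rangle> *\<^sub>J b)"
    using closed_loop unfolding generates_poly_stable_def by metis
  then obtain R where R: "range R \<subseteq> D" "\<And>y. s *\<^sub>J R y - (A (R y) + \<langle>R y, f\<rangle> *\<^sub>J b) = y"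
    unfolding op_resolvent_set_def by blast
  then have "R x \<in> D" by blast
  then show ?thesis
    using arg_cong[OF R(2)[of x], of "\<lambda>y. \<langle>y, g\<rangle>"] eig[of "R x"]
    by (simp add: cinner_diff_left cinner_scaleC_left)
next
  case False
  with s have "Re s > 0" by simp
  obtain U M where "c0_semigroup J U" "is_generator U D (\<lambda>x. A x + \<langle>x, f\<rangle> *\<^sub>J b)"
    "\<And>t x. t \<ge> 0 \<Longrightarrow> norm (U t x) \<le> M * norm x"
    using closed_loop unfolding generates_poly_stable_def by blast
  from bounded_semigroup_no_unstable_coeigenvector[OF this x \<open>Re s > 0\<close> eig]
  show ?thesis by blast
qed

text \<open>Hautus test: if \<open>b\<close> had no component in mode \<open>m\<close>, feedback
  could not move it, and \<open>\<psi> m\<close> would remain an eigenvector of the adjoint of the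
  closed loop.\<close>

lemma unstable_mode_controllable:
  assumes "Re (lam m) \<ge> 0"
  shows "\<langle>b, \<psi> m\<rangle> \<noteq> 0"
proof
  assume "\<langle>b, \<psi> m\<rangle> = 0"
  then have "\<langle>\<phi> m, \<psi> m\<rangle> = 0"
    by (intro no_unstable_coeigenvector[OF assms basis_in_rs_dom])
      (simp add: cinner_add_left cinner_scaleC_left cinner_rs_op)
  then show False by (simp add: biorthogonal)
qed

text \<open>Dually, if \<open>f\<close> did not see \<open>\<phi> m\<close>, this vector would
  remain an eigenvector of the closed loop.\<close>

lemma unstable_mode_observable:
  assumes "Re (lam m) \<ge> 0"
  shows "\<langle>\<phi> m, f\<rangle> \<noteq> 0"
proof
  assume 0: "\<langle>\<phi> m, f\<rangle> = 0"
  have "A (\<phi> m) = lam m *\<^sub>J \<phi> m"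
    by (rule coefficients_eqI) (simp add: cinner_rs_op basis_in_rs_dom cinner_scaleC_left biorthogonal)
  then have "\<phi> m = 0"
    using 0 by (intro no_unstable_eigenvector[OF assms basis_in_rs_dom]) simp
  then show False using biorthogonal[of m m] by simp
qed

text \<open>In the region of (A1) \<open>1 / \<bar>Re (lam n)\<bar>\<close> grows at most like
  \<open>cmod (lam n) powr \<alpha>\<close>. The smoothness
  \<open>\<beta> + \<gamma> \<ge> \<alpha>\<close> absorbs this growth, and
  \<open>2 * p * q \<le> p\<^sup>2 + q\<^sup>2\<close> splits the product into the two series of
  (A4).\<close>

lemma summable_weights: "summable (\<lambda>n. if n \<in> exceptional then 0 else cmod (coupling n) / \<bar>Re (lam n)\<bar>)"
proof -
  obtain \<beta> \<gamma> where \<beta>\<gamma>: "\<beta> \<ge> 0" "\<gamma> \<ge> 0" "\<beta> + \<gamma> \<ge> \<alpha>"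
    and sb: "summable (\<lambda>n. cmod (lam n) powr (2 * \<beta>) * (cmod \<langle>b, \<psi> n\<rangle>)\<^sup>2)"
    and sf: "summable (\<lambda>n. cmod (lam n) powr (2 * \<gamma>) * (cmod \<langle>f, \<phi> n\<rangle>)\<^sup>2)"
    using smooth by (auto simp: D_beta_def D_gamma_star_def)
  \<comment> \<open>The first summand of \<open>?B\<close> serves eigenvalues with real part at most
    \<open>- \<omega>\<close>, the second those in
    \<open>Omega_set \<alpha> \<Upsilon>\<close>.\<close>
  let ?B = "\<lambda>n. cmod (coupling n) / \<omega> + (cmod (coupling n) + (cmod (lam n) powr (2 * \<beta>) * (cmod \<langle>b, \<psi> n\<rangle>)\<^sup>2
      + cmod (lam n) powr (2 * \<gamma>) * (cmod \<langle>f, \<phi> n\<rangle>)\<^sup>2)) / \<Upsilon>"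
  show ?thesis
  proof (rule summable_comparison_test'[where N = 0])
    show "summable ?B"
      using summable_cinner_products[of b f] sb sf unfolding coupling_def
      by (intro summable_add summable_divide)
    fix n
    show "norm (if n \<in> exceptional then 0 else cmod (coupling n) / \<bar>Re (lam n)\<bar>) \<le> ?B n"
    proof (cases "n \<in> exceptional")
      case True
      then show ?thesis using positive by (auto intro!: add_nonneg_nonneg divide_nonneg_pos)
    next
      case False
      let ?l = "cmod (lam n)"
      note neg = Re_neg[OF False]
      show ?thesis
      proof (cases "\<omega> \<le> - Re (lam n)")
        case True
        have "cmod (coupling n) / \<bar>Re (lam n)\<bar> \<le> cmod (coupling n) / \<omega>"
          using True positive neg by (intro divide_left_mono mult_pos_pos) auto
        moreover have "0 \<le> (cmod (coupling n) + (?l powr (2 * \<beta>) * (cmod \<langle>b, \<psi> n\<rangle>)\<^sup>2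
            + ?l powr (2 * \<gamma>) * (cmod \<langle>f, \<phi> n\<rangle>)\<^sup>2)) / \<Upsilon>"
          using positive by (auto intro!: add_nonneg_nonneg divide_nonneg_pos)
        ultimately show ?thesis using False by simp
      next
        case gap: False
        with spectral_gap[OF False] have im: "Im (lam n) \<noteq> 0" "\<Upsilon> \<le> - Re (lam n) * \<bar>Im (lam n)\<bar> powr \<alpha>"
          by auto
        have l: "?l > 0" using im(1) by auto
        have "\<bar>Im (lam n)\<bar> powr \<alpha> \<le> ?l powr \<alpha>"
          using positive abs_Im_le_cmod by (intro powr_mono2) auto
        \<comment> \<open>The 1 covers \<open>?l \<le> 1\<close>, where raising the exponent from
          \<alpha> to \<open>\<beta> + \<gamma>\<close> does not increase the power.\<close>
        also have "\<dots> \<le> 1 + ?l powr (\<beta> + \<gamma>)"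
        proof (cases "?l \<le> 1")
          case True
          then have "?l powr \<alpha> \<le> 1" using l positive by (simp add: powr_le1)
          then show ?thesis by (simp add: add_increasing2)
        next
          case False
          then have "?l powr \<alpha> \<le> ?l powr (\<beta> + \<gamma>)" using \<beta>\<gamma> by (intro powr_mono) auto
          then show ?thesis by simp
        qed
        finally have "- Re (lam n) * \<bar>Im (lam n)\<bar> powr \<alpha> \<le> - Re (lam n) * (1 + ?l powr (\<beta> + \<gamma>))"
          using neg by (intro mult_left_mono) auto
        with im(2) have "1 / \<bar>Re (lam n)\<bar> \<le> (1 + ?l powr (\<beta> + \<gamma>)) / \<Upsilon>"
          using neg positive by (simp add: field_simps)
        then have "cmod (coupling n) * (1 / \<bar>Re (lam n)\<bar>) \<le> cmod (coupling n) * ((1 + ?l powr (\<beta> + \<gamma>)) / \<Upsilon>)"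
          by (rule mult_left_mono) simp
        also have "\<dots> = (cmod (coupling n) + ?l powr (\<beta> + \<gamma>) * cmod (coupling n)) / \<Upsilon>"
          by (simp add: field_simps)
        also have "?l powr (\<beta> + \<gamma>) * cmod (coupling n) \<le> ?l powr (2 * \<beta>) * (cmod \<langle>b, \<psi> n\<rangle>)\<^sup>2
            + ?l powr (2 * \<gamma>) * (cmod \<langle>f, \<phi> n\<rangle>)\<^sup>2"
        proof -
          let ?p = "?l powr \<beta> * cmod \<langle>b, \<psi> n\<rangle>" and ?q = "?l powr \<gamma> * cmod \<langle>f, \<phi> n\<rangle>"
          have "?l powr (\<beta> + \<gamma>) * cmod (coupling n) = ?p * ?q"
            using cinner_commute[of f "\<phi> n"] by (simp add: coupling_def norm_mult powr_add)
          moreover have "?p * ?q \<ge> 0" by simp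
          moreover have "2 * ?p * ?q \<le> ?p\<^sup>2 + ?q\<^sup>2" by (rule sum_squares_bound)
          moreover have "?p\<^sup>2 = ?l powr (2 * \<beta>) * (cmod \<langle>b, \<psi> n\<rangle>)\<^sup>2" "?q\<^sup>2 = ?l powr (2 * \<gamma>) * (cmod \<langle>f, \<phi> n\<rangle>)\<^sup>2"
            by (simp_all add: power_mult_distrib power2_eq_square flip: powr_add)
          ultimately show ?thesis by linarith
        qed
        finally have "cmod (coupling n) / \<bar>Re (lam n)\<bar> \<le> (cmod (coupling n) + (?l powr (2 * \<beta>) * (cmod \<langle>b, \<psi> n\<rangle>)\<^sup>2
            + ?l powr (2 * \<gamma>) * (cmod \<langle>f, \<phi> n\<rangle>)\<^sup>2)) / \<Upsilon>"
          using positive by (simp add: divide_right_mono)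
        moreover have "0 \<le> cmod (coupling n) / \<omega>" using positive by simp
        ultimately show ?thesis using False by simp
      qed
    qed
  qed
qed

section \<open>Integrals of the exponentials over one sampling period\<close>

definition \<sigma> :: "real \<Rightarrow> nat \<Rightarrow> complex" where
  "\<sigma> \<tau> n = (if lam n = 0 then of_real \<tau> else (exp (of_real \<tau> * lam n) - 1) / lam n)"

lemma exp_eq_\<sigma>: "exp (of_real \<tau> * lam n) = 1 + lam n * \<sigma> \<tau> n"
  by (simp add: \<sigma>_def)

lemma has_integral_\<sigma>:
  assumes "\<tau> \<ge> 0"
  shows "((\<lambda>s. exp (of_real s * lam n)) has_integral \<sigma> \<tau> n) {0..\<tau>}"
proof (cases "lam n = 0")
  case True
  then show ?thesis
    using has_integral_const_real[of "1::complex" 0 \<tau>] assms by (simp add: \<sigma>_def scaleR_conv_of_real)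
next
  case False
  have "((\<lambda>s. exp (of_real s * lam n)) has_integral
     (exp (of_real \<tau> * lam n) / lam n - exp (of_real 0 * lam n) / lam n)) {0..\<tau>}"
  proof (rule fundamental_theorem_of_calculus[OF assms])
    fix s :: real
    have "((\<lambda>w. exp (w * lam n) / lam n) has_field_derivative exp (of_real s * lam n)) (at (of_real s))"
      using False by (auto intro!: derivative_eq_intros)
    then have "((\<lambda>s. exp (of_real s * lam n) / lam n) has_vector_derivative exp (of_real s * lam n)) (at s)"
      by (rule has_vector_derivative_real_field)
    then show "((\<lambda>s. exp (of_real s * lam n) / lam n) has_vector_derivative exp (of_real s * lam n)) (at s within {0..\<tau>})"
      by (rule has_vector_derivative_at_within)
  qed
  then show ?thesis using False by (simp add: \<sigma>_def diff_divide_distrib)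
qed

lemma exp_bounded:
  obtains K where "K > 0" "\<And>n s. s \<in> {0..\<tau>} \<Longrightarrow> cmod (exp (of_real s * lam n)) \<le> K"
proof -
  obtain K where K: "K \<ge> 0" "\<And>n. Re (lam n) \<le> K" by (rule Re_bounded) blast
  have "cmod (exp (of_real s * lam n)) \<le> exp (\<tau> * K)" if "s \<in> {0..\<tau>}" for s n
  proof -
    have "s * Re (lam n) \<le> s * K" using K(2) that by (intro mult_left_mono) auto
    also have "\<dots> \<le> \<tau> * K" using K(1) that by (intro mult_right_mono) auto
    finally show ?thesis by simp
  qed
  with that[of "exp (\<tau> * K)"] show ?thesis by simp
qed

lemma \<sigma>_bounded:
  assumes "\<tau> \<ge> 0"
  obtains K where "\<And>n. cmod (\<sigma> \<tau> n) \<le> K"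
proof -
  obtain K where K: "K > 0" "\<And>n s. s \<in> {0..\<tau>} \<Longrightarrow> cmod (exp (of_real s * lam n)) \<le> K"
    by (rule exp_bounded[of \<tau>]) blast
  have "cmod (\<sigma> \<tau> n) \<le> K * \<tau>" for n
    using has_integral_bound[of K "\<lambda>s. exp (of_real s * lam n)" "\<sigma> \<tau> n" 0 \<tau>] K assms has_integral_\<sigma>[OF assms]
    by simp
  then show ?thesis by (rule that)
qed

lemma norm_\<sigma>_le:
  assumes "\<tau> \<ge> 0" and neg: "Re (lam n) < 0"
  shows "cmod (\<sigma> \<tau> n) \<le> (1 - exp (\<tau> * Re (lam n))) / \<bar>Re (lam n)\<bar>"
proof -
  \<comment> \<open>\<open>?mean_exp\<close> stands for the real part of the eigenvalue here, not
    for the averaged exponential \<open>mean_exp\<close> introduced later.\<close>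
  let ?mean_exp = "Re (lam n)"
  have "((\<lambda>s. exp (s * ?mean_exp)) has_integral (exp (\<tau> * ?mean_exp) / ?mean_exp - exp (0 * ?mean_exp) / ?mean_exp)) {0..\<tau>}"
    using neg by (intro fundamental_theorem_of_calculus[OF assms(1)])
      (auto intro!: derivative_eq_intros simp: has_real_derivative_iff_has_vector_derivative[symmetric])
  moreover have "exp (\<tau> * ?mean_exp) / ?mean_exp - exp (0 * ?mean_exp) / ?mean_exp = (1 - exp (\<tau> * ?mean_exp)) / \<bar>?mean_exp\<bar>"
    using neg by (simp add: field_simps)
  ultimately have I: "((\<lambda>s. exp (s * ?mean_exp)) has_integral (1 - exp (\<tau> * ?mean_exp)) / \<bar>?mean_exp\<bar>) {0..\<tau>}" by simp
  have "cmod (integral {0..\<tau>} (\<lambda>s. exp (of_real s * lam n))) \<le> integral {0..\<tau>} (\<lambda>s. exp (s * ?mean_exp))"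
    using I has_integral_\<sigma>[OF assms(1)] by (intro integral_norm_bound_integral) auto
  then show ?thesis
    using integral_unique[OF I] integral_unique[OF has_integral_\<sigma>[OF assms(1)]] by simp
qed

text \<open>For \<open>cmod z > 1\<close> the denominator is at least
  \<open>1 - exp (\<tau> * Re (lam n))\<close>, and the bound on \<open>\<sigma>\<close> contains
  the same factor. It cancels, leaving a bound free of \<tau> and \<open>z\<close>, as dominated
  convergence requires.\<close>

lemma \<sigma>_quotient_bound:
  assumes "\<tau> > 0" "n \<notin> exceptional" "cmod z > 1"
  shows "cmod (\<sigma> \<tau> n / (z - exp (of_real \<tau> * lam n))) \<le> 1 / \<bar>Re (lam n)\<bar>"
proof -
  let ?mean_exp = "Re (lam n)"
  have neg: "?mean_exp < 0" by (rule Re_neg[OF assms(2)])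
  have e: "exp (\<tau> * ?mean_exp) < 1" using neg assms(1) by (simp add: mult_pos_neg)
  have "1 - exp (\<tau> * ?mean_exp) \<le> cmod (z - exp (of_real \<tau> * lam n))"
    using norm_triangle_ineq2[of z "exp (of_real \<tau> * lam n)"] assms(3) by simp
  moreover have "cmod (\<sigma> \<tau> n) \<le> (1 - exp (\<tau> * ?mean_exp)) / \<bar>?mean_exp\<bar>"
    using norm_\<sigma>_le assms(1) neg by simp
  ultimately have "cmod (\<sigma> \<tau> n) / cmod (z - exp (of_real \<tau> * lam n)) \<le> (1 - exp (\<tau> * ?mean_exp)) / \<bar>?mean_exp\<bar> / (1 - exp (\<tau> * ?mean_exp))"
    using e by (intro frac_le) auto
  moreover have "(1 - exp (\<tau> * ?mean_exp)) / \<bar>?mean_exp\<bar> / (1 - exp (\<tau> * ?mean_exp)) = 1 / \<bar>?mean_exp\<bar>"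
    using e by (simp only: divide_divide_eq_left nonzero_divide_mult_cancel_right)
  ultimately show ?thesis by (simp only: norm_divide)
qed

text \<open>For \<open>lam n \<noteq> 0\<close> this is the derivative at 0 of
  \<open>exp (w * lam n) / lam n\<close>, approached along the positive reals.\<close>

lemma \<sigma>_limit: "((\<lambda>\<tau>. \<sigma> \<tau> n / of_real \<tau>) \<longlongrightarrow> 1) (at_right 0)"
proof (cases "lam n = 0")
  case True
  have "\<forall>\<^sub>F \<tau> in at_right (0::real). 1 = \<sigma> \<tau> n / of_real \<tau>"
    using True by (auto simp: \<sigma>_def eventually_at_filter)
  then show ?thesis by (rule Lim_transform_eventually[OF tendsto_const])
next
  case False
  have "((\<lambda>w. exp (w * lam n) / lam n) has_field_derivative 1) (at 0)"
    using False by (auto intro!: derivative_eq_intros)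
  then have "((\<lambda>w. (exp (w * lam n) / lam n - 1 / lam n) / w) \<longlongrightarrow> 1) (at 0)"
    by (simp add: has_field_derivative_iff)
  moreover have "filterlim complex_of_real (at 0) (at_right 0)"
    unfolding filterlim_at by (auto simp: eventually_at_filter intro!: tendsto_eq_intros)
  ultimately have "((\<lambda>\<tau>. (exp (of_real \<tau> * lam n) / lam n - 1 / lam n) / of_real \<tau>) \<longlongrightarrow> 1) (at_right 0)"
    by (rule filterlim_compose)
  then show ?thesis using False by (simp add: \<sigma>_def diff_divide_distrib)
qed

text \<open>Termwise integration turns the input operator into
  \<open>diagonal (\<sigma> \<tau>)\<close> applied to a multiple of \<open>b\<close>, which puts
  \<open>Delta\<close> in the form treated by the rank-one resolvent lemmas.\<close>

lemma Delta_eq: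
  assumes "\<tau> \<ge> 0"
  shows "Delta J lam \<phi> \<psi> b f \<tau> x = diagonal (\<lambda>n. exp (of_real \<tau> * lam n)) x + \<langle>x, f\<rangle> *\<^sub>J diagonal (\<sigma> \<tau>) b"
proof -
  have sg: "rs_semigroup J lam \<phi> \<psi> s y = diagonal (\<lambda>n. exp (of_real s * lam n)) y" for s y
    by (simp add: rs_semigroup_def diagonal_def synthesis_def)
  obtain K where K: "\<And>n s. s \<in> {0..\<tau>} \<Longrightarrow> cmod (exp (of_real s * lam n)) \<le> K"
    by (rule exp_bounded[of \<tau>]) blast
  obtain K' where K': "\<And>n. cmod (\<sigma> \<tau> n) \<le> K'"
    by (rule \<sigma>_bounded[OF assms]) blast
  have "sample_S J lam \<phi> \<psi> b \<tau> u = diagonal (\<sigma> \<tau>) (u *\<^sub>J b)" for u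
    unfolding sample_S_def sg
    by (intro integral_unique has_integral_diagonal[OF assms K has_integral_\<sigma>[OF assms]])
  then show ?thesis
    by (simp add: Delta_def sg bounded_clinear_scaleC[OF bounded_clinear_diagonal[OF K']])
qed


section \<open>Rescaling and the characteristic equation\<close>

definition mean_exp where "mean_exp \<tau> n = \<sigma> \<tau> n / of_real \<tau>"

text \<open>The substitution \<open>z = 1 + \<tau> p\<close> exposes a common factor \<tau>. After
  cancelling it, the term approaches \<open>1 / (p - lam n)\<close>, since \<open>mean_exp\<close>,
  the average of the exponential over \<open>{0..\<tau>}\<close>, tends to 1.\<close>

lemma quotient_rescaled:
  assumes "\<tau> > 0"
  shows "\<sigma> \<tau> n / (1 + of_real \<tau> * p - exp (of_real \<tau> * lam n)) = mean_exp \<tau> n / (p - lam n * mean_exp \<tau> n)"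
proof -
  have "1 + of_real \<tau> * p - exp (of_real \<tau> * lam n) = of_real \<tau> * (p - lam n * mean_exp \<tau> n)"
    using assms by (simp add: exp_eq_\<sigma> mean_exp_def algebra_simps)
  moreover have "\<sigma> \<tau> n = of_real \<tau> * mean_exp \<tau> n"
    using assms by (simp add: mean_exp_def)
  ultimately show ?thesis using assms by simp
qed

lemma norm_exp_off_exceptional: "n \<notin> exceptional \<Longrightarrow> \<tau> > 0 \<Longrightarrow> cmod (exp (of_real \<tau> * lam n)) < 1"
  using Re_neg[of n] by (simp add: mult_pos_neg)

lemma semigroup_bounded:
  assumes "\<tau> > 0"
  obtains K where "\<And>n. cmod (exp (of_real \<tau> * lam n)) \<le> K"
proof -
  obtain K where K: "\<And>n s. s \<in> {0..\<tau>} \<Longrightarrow> cmod (exp (of_real s * lam n)) \<le> K"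
    by (rule exp_bounded[of \<tau>]) blast
  have "\<tau> \<in> {0..\<tau>}" using assms by simp
  then show ?thesis using that[of K] K by blast
qed

text \<open>Off the exceptional set the exponentials lie in the unit disc; the remaining indices
  contribute a finite sum. An index with \<open>z = exp (\<tau> * lam n)\<close> contributes 0
  because \<open>1 / 0 = 0\<close>, so the bound also serves the singular case.\<close>

lemma inverse_bounded:
  assumes "\<tau> > 0" "cmod z > 1"
  obtains K where "\<And>n. cmod (1 / (z - exp (of_real \<tau> * lam n))) \<le> K"
proof -
  have "cmod (1 / (z - exp (of_real \<tau> * lam n))) \<le> 1 / (cmod z - 1)" if "n \<notin> exceptional" for n
  proof -
    have "cmod z - 1 \<le> cmod (z - exp (of_real \<tau> * lam n))"
      using norm_triangle_ineq2[of z "exp (of_real \<tau> * lam n)"] norm_exp_off_exceptional[OF that assms(1)] by linarith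
    then show ?thesis using assms(2) by (simp add: norm_divide frac_le)
  qed
  then show ?thesis
    using assms(2) by (intro that[of "1 / (cmod z - 1) + (\<Sum>n\<in>exceptional. cmod (1 / (z - exp (of_real \<tau> * lam n))))"] bounded_off_exceptional) auto
qed

lemma Delta_fun_eq:
  "\<tau> > 0 \<Longrightarrow> Delta J lam \<phi> \<psi> b f \<tau> = (\<lambda>x. diagonal (\<lambda>n. exp (of_real \<tau> * lam n)) x + \<langle>x, f\<rangle> *\<^sub>J diagonal (\<sigma> \<tau>) b)"
  using Delta_eq by (intro ext) simp

text \<open>Contrapositive of \<open>resolvent_rank_one_regular\<close>, with the scalar condition
  expanded in the Riesz basis.\<close>

lemma characteristic_equation:
  assumes \<tau>: "\<tau> > 0" and z: "cmod z > 1" and reg: "\<And>n. z \<noteq> exp (of_real \<tau> * lam n)"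
    and spec: "z \<notin> bounded_resolvent_set J (Delta J lam \<phi> \<psi> b f \<tau>)"
  shows "(\<lambda>n. coupling n * (\<sigma> \<tau> n / (z - exp (of_real \<tau> * lam n)))) sums 1"
proof -
  obtain K where K: "\<And>n. cmod (exp (of_real \<tau> * lam n)) \<le> K"
    by (rule semigroup_bounded[OF \<tau>]) blast
  obtain K' where K': "\<And>n. cmod (1 / (z - exp (of_real \<tau> * lam n))) \<le> K'"
    by (rule inverse_bounded[OF \<tau> z]) blast
  obtain K'' where K'': "\<And>n. cmod (\<sigma> \<tau> n) \<le> K''"
    by (rule \<sigma>_bounded[OF less_imp_le[OF \<tau>]]) blast
  let ?x = "diagonal (\<lambda>n. 1 / (z - exp (of_real \<tau> * lam n))) (diagonal (\<sigma> \<tau>) b)"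
  have "\<langle>?x, f\<rangle> = 1"
    using resolvent_rank_one_regular[where e = "\<lambda>n. exp (of_real \<tau> * lam n)", OF K reg K', where v = "diagonal (\<sigma> \<tau>) b" and f = f] spec
    unfolding Delta_fun_eq[OF \<tau>] by blast
  with cinner_sums[of ?x f] show ?thesis
    by (simp add: cinner_diagonal[OF K'] cinner_diagonal[OF K''] coupling_def mult_ac)
qed

text \<open>An eigenvalue of the diagonal part outside the unit disc comes from
  \<open>Re (lam m) > 0\<close>, where the mode is controllable and observable, so the feedback
  removes it from the spectrum.\<close>

lemma unstable_spectrum_resolvent:
  assumes \<tau>: "\<tau> > 0" and z: "cmod z > 1" and m: "z = exp (of_real \<tau> * lam m)"
    and simple: "\<And>n. n \<noteq> m \<Longrightarrow> z \<noteq> exp (of_real \<tau> * lam n)"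
  shows "z \<in> bounded_resolvent_set J (Delta J lam \<phi> \<psi> b f \<tau>)"
proof -
  obtain K where K: "\<And>n. cmod (exp (of_real \<tau> * lam n)) \<le> K"
    by (rule semigroup_bounded[OF \<tau>]) blast
  obtain K' where K': "\<And>n. cmod (1 / (z - exp (of_real \<tau> * lam n))) \<le> K'"
    by (rule inverse_bounded[OF \<tau> z]) blast
  obtain K'' where K'': "\<And>n. cmod (\<sigma> \<tau> n) \<le> K''"
    by (rule \<sigma>_bounded[OF less_imp_le[OF \<tau>]]) blast
  have re: "Re (lam m) > 0"
    using z \<tau> unfolding m by (simp add: zero_less_mult_iff)
  \<comment> \<open>Otherwise \<open>z = 1 + lam m * \<sigma> \<tau> m\<close> would equal
    1.\<close>
  have "\<sigma> \<tau> m \<noteq> 0"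
    using exp_eq_\<sigma>[of \<tau> m] z m by auto
  then have "\<langle>diagonal (\<sigma> \<tau>) b, \<psi> m\<rangle> \<noteq> 0"
    using unstable_mode_controllable[of m] re by (simp add: cinner_diagonal[OF K''])
  then show ?thesis
    unfolding Delta_fun_eq[OF \<tau>]
    using unstable_mode_observable[of m] re by (intro resolvent_rank_one_singular[where e = "\<lambda>n. exp (of_real \<tau> * lam n)", OF K m simple K']) auto
qed

text \<open>Distinct eigenvalues may alias under \<open>exp\<close>. For small \<tau> this cannot
  happen within a finite set, since \<open>(exp (\<tau> * lam n) - 1) / \<tau>\<close> tends to
  \<open>lam n\<close>.\<close>

lemma eventually_simple_spectrum:
  "\<forall>\<^sub>F \<tau> in at_right 0. \<forall>m\<in>exceptional. \<forall>n\<in>exceptional. m \<noteq> n \<longrightarrow> exp (complex_of_real \<tau> * lam m) \<noteq> exp (of_real \<tau> * lam n)"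
proof (intro eventually_ball_finite finite_exceptional_set ballI)
  fix m n assume "m \<in> exceptional" "n \<in> exceptional"
  show "\<forall>\<^sub>F \<tau> in at_right 0. m \<noteq> n \<longrightarrow> exp (complex_of_real \<tau> * lam m) \<noteq> exp (of_real \<tau> * lam n)"
  proof (cases "m = n")
    case False
    have "((\<lambda>\<tau>. lam m * mean_exp \<tau> m - lam n * mean_exp \<tau> n) \<longlongrightarrow> lam m * 1 - lam n * 1) (at_right 0)"
      unfolding mean_exp_def by (intro tendsto_intros \<sigma>_limit)
    moreover have "lam m * 1 - lam n * 1 \<noteq> 0"
      using inj_lam False by (auto dest: injD)
    ultimately have "\<forall>\<^sub>F \<tau> in at_right 0. lam m * mean_exp \<tau> m - lam n * mean_exp \<tau> n \<noteq> 0"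
      by (rule tendsto_imp_eventually_ne)
    then show ?thesis
      by eventually_elim (auto simp: exp_eq_\<sigma> mean_exp_def)
  qed simp
qed

section \<open>Limits as the sampling period tends to zero\<close>

lemma dominated_sums:
  assumes pos: "\<And>k. \<tau> k > 0" and big: "\<And>k. cmod (1 + of_real (\<tau> k) * p k) > 1"
    and a: "\<And>n. cmod (a n) \<le> cmod (coupling n)"
    and lim: "\<And>n. (\<lambda>k. a n * (mean_exp (\<tau> k) n / (p k - lam n * mean_exp (\<tau> k) n))) \<longlonglongrightarrow> l n"
  shows "(\<lambda>k. \<Sum>n. a n * (mean_exp (\<tau> k) n / (p k - lam n * mean_exp (\<tau> k) n))) \<longlonglongrightarrow> suminf l"
    and "summable l"
proof -
  \<comment> \<open>Tannery's theorem asks for the majorant \<open>summable_weights\<close> from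
    some index on, so the finitely many exceptional terms are skipped. The weights \<open>a\<close>
    in place of \<open>coupling\<close> permit deleting a single mode.\<close>
  obtain N where N: "exceptional \<subseteq> {..<N}" using finite_exceptional_set finite_nat_iff_bounded by blast
  have "cmod (a n * (mean_exp (\<tau> k) n / (p k - lam n * mean_exp (\<tau> k) n))) \<le> (if n \<in> exceptional then 0 else cmod (coupling n) / \<bar>Re (lam n)\<bar>)"
    if "n \<ge> N" for n k
  proof -
    have n: "n \<notin> exceptional" using N that by auto
    have "cmod (mean_exp (\<tau> k) n / (p k - lam n * mean_exp (\<tau> k) n)) \<le> 1 / \<bar>Re (lam n)\<bar>"
      using \<sigma>_quotient_bound[OF pos n big, of k k] unfolding quotient_rescaled[OF pos] .
    then have "cmod (a n * (mean_exp (\<tau> k) n / (p k - lam n * mean_exp (\<tau> k) n))) \<le> cmod (coupling n) * (1 / \<bar>Re (lam n)\<bar>)"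
      using a unfolding norm_mult by (intro mult_mono) auto
    then show ?thesis using n by (simp del: times_divide_eq_right add: times_divide_eq_right[of "cmod (coupling n)"])
  qed
  then have "\<forall>\<^sub>F (n, k) in sequentially \<times>\<^sub>F sequentially.
      norm (a n * (mean_exp (\<tau> k) n / (p k - lam n * mean_exp (\<tau> k) n))) \<le> (if n \<in> exceptional then 0 else cmod (coupling n) / \<bar>Re (lam n)\<bar>)"
    unfolding eventually_prod_sequentially case_prod_conv by blast
  from tannerys_theorem[OF lim this summable_weights sequentially_bot]
  show "(\<lambda>k. \<Sum>n. a n * (mean_exp (\<tau> k) n / (p k - lam n * mean_exp (\<tau> k) n))) \<longlonglongrightarrow> suminf l" "summable l"
    by (auto intro: summable_norm_cancel)
qed

text \<open>The eigenvalues can approach the imaginary axis only at infinity, so a point of the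
  closed right half-plane that is not one of them has positive distance from all of them.\<close>

lemma inverse_distance_bounded:
  assumes p: "Re p \<ge> 0" "\<And>n. p \<noteq> lam n"
  obtains K where "\<And>n. cmod (1 / (p - lam n)) \<le> K"
proof -
  \<comment> \<open>The three gaps: unit vertical distance from \<open>p\<close>, real part at most
    \<open>- \<omega>\<close>, and the depth of \<open>Omega_set\<close> at heights up to
    \<open>\<bar>Im p\<bar> + 1\<close>.\<close>
  define \<delta> where "\<delta> = min 1 (min \<omega> (\<Upsilon> / (\<bar>Im p\<bar> + 1) powr \<alpha>))"
  have \<delta>: "\<delta> > 0" using positive by (simp add: \<delta>_def)
  have "cmod (1 / (p - lam n)) \<le> 1 / \<delta>" if n: "n \<notin> exceptional" for n
  proof -
    have neg: "Re (lam n) < 0" by (rule Re_neg[OF n])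
    have re: "- Re (lam n) \<le> cmod (p - lam n)"
      using abs_Re_le_cmod[of "p - lam n"] p(1) neg by simp
    have im: "\<bar>Im p - Im (lam n)\<bar> \<le> cmod (p - lam n)"
      using abs_Im_le_cmod[of "p - lam n"] by simp
    have "\<delta> \<le> cmod (p - lam n)"
    proof (cases "\<omega> \<le> - Re (lam n) \<or> \<bar>Im p - Im (lam n)\<bar> \<ge> 1")
      case True
      then show ?thesis using re im by (auto simp: \<delta>_def)
    next
      case False
      with spectral_gap[OF n] have g: "\<Upsilon> \<le> - Re (lam n) * \<bar>Im (lam n)\<bar> powr \<alpha>" by auto
      also have "\<bar>Im (lam n)\<bar> powr \<alpha> \<le> (\<bar>Im p\<bar> + 1) powr \<alpha>"
        using False positive by (intro powr_mono2) auto
      finally have "\<Upsilon> \<le> - Re (lam n) * (\<bar>Im p\<bar> + 1) powr \<alpha>"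
        using neg by (simp add: mult_left_mono)
      moreover have "(\<bar>Im p\<bar> + 1) powr \<alpha> > 0" by simp
      ultimately have "\<Upsilon> / (\<bar>Im p\<bar> + 1) powr \<alpha> \<le> - Re (lam n)"
        by (simp only: pos_divide_le_eq)
      with re show ?thesis by (simp add: \<delta>_def)
    qed
    with \<delta> show ?thesis by (simp add: norm_divide frac_le)
  qed
  then show ?thesis
    using \<delta> by (intro that[of "1 / \<delta> + (\<Sum>n\<in>exceptional. cmod (1 / (p - lam n)))"] bounded_off_exceptional) auto
qed

text \<open>If the sum were 1, then \<open>x = (p - A)^-1 b\<close> would satisfy
  \<open>\<langle>x, f\<rangle> = 1\<close> and hence be an eigenvector of the closed loop for
  \<open>p\<close>.\<close>

lemma transfer_function_ne_1:
  assumes p: "Re p \<ge> 0" "\<And>n. p \<noteq> lam n"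
  shows "\<not> (\<lambda>n. coupling n / (p - lam n)) sums 1"
proof
  assume sums: "(\<lambda>n. coupling n / (p - lam n)) sums 1"
  obtain K where K: "\<And>n. cmod (1 / (p - lam n)) \<le> K"
    by (rule inverse_distance_bounded[OF p]) blast
  define x where "x = diagonal (\<lambda>n. 1 / (p - lam n)) b"
  have coef: "\<langle>x, \<psi> n\<rangle> = \<langle>b, \<psi> n\<rangle> / (p - lam n)" for n
    by (simp add: x_def cinner_diagonal[OF K])
  \<comment> \<open>Written this way, \<open>lam n\<close> times the coefficient is a combination of
    two square-summable sequences, which puts \<open>x\<close> in the domain.\<close>
  have lamx: "lam n * \<langle>x, \<psi> n\<rangle> = p * \<langle>x, \<psi> n\<rangle> + (- 1) * \<langle>b, \<psi> n\<rangle>" for n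
    using p(2)[of n] by (simp add: coef field_simps)
  have "x \<in> D"
    unfolding square_summable_rs_dom lamx
    by (intro square_summable_add square_summable_mult_bounded[OF order_refl square_summable_coefficients])
  have xf: "\<langle>x, f\<rangle> = 1"
    using sums_unique2[OF cinner_sums[of x f], of 1] sums by (simp add: coef coupling_def)
  have "A x + \<langle>x, f\<rangle> *\<^sub>J b = p *\<^sub>J x"
    by (rule coefficients_eqI)
      (simp add: xf cinner_add_left cinner_scaleC_left cinner_rs_op[OF \<open>x \<in> D\<close>] lamx)
  from no_unstable_eigenvector[OF p(1) \<open>x \<in> D\<close> this] xf show False by simp
qed

text \<open>Every single term would tend to 0 while the sums stay at 1, against dominated
  convergence.\<close>

lemma no_limit_at_infinity:
  assumes pos: "\<And>k. \<tau> k > 0" and \<tau>: "filterlim \<tau> (at_right 0) sequentially"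
    and big: "\<And>k. cmod (1 + of_real (\<tau> k) * p k) > 1"
    and sums: "\<And>k. (\<lambda>n. coupling n * (mean_exp (\<tau> k) n / (p k - lam n * mean_exp (\<tau> k) n))) sums 1"
  shows "\<not> filterlim p at_infinity sequentially"
proof
  assume p: "filterlim p at_infinity sequentially"
  have mean_exp: "(\<lambda>k. mean_exp (\<tau> k) n) \<longlonglongrightarrow> 1" for n
    using filterlim_compose[OF \<sigma>_limit[of n] \<tau>] by (simp add: mean_exp_def)
  have "(\<lambda>k. coupling n * (mean_exp (\<tau> k) n / (p k - lam n * mean_exp (\<tau> k) n))) \<longlonglongrightarrow> 0" for n
  proof -
    have "filterlim (\<lambda>k. p k + - (lam n * mean_exp (\<tau> k) n)) at_infinity sequentially"
      by (rule tendsto_add_filterlim_at_infinity'[OF p tendsto_minus[OF tendsto_mult[OF tendsto_const mean_exp]]])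
    from tendsto_mult[OF tendsto_const tendsto_divide_0[OF mean_exp this], of "coupling n" n] show ?thesis by simp
  qed
  from dominated_sums(1)[OF pos big order_refl this] have "(\<lambda>k. 1) \<longlonglongrightarrow> (0::complex)"
    using sums_unique[OF sums] by simp
  then show False by (simp add: LIMSEQ_const_iff)
qed

lemma no_finite_limit:
  assumes pos: "\<And>k. \<tau> k > 0" and \<tau>: "filterlim \<tau> (at_right 0) sequentially"
    and big: "\<And>k. cmod (1 + of_real (\<tau> k) * p k) > 1"
    and reg: "\<And>n k. p k \<noteq> lam n * mean_exp (\<tau> k) n"
    and sums: "\<And>k. (\<lambda>n. coupling n * (mean_exp (\<tau> k) n / (p k - lam n * mean_exp (\<tau> k) n))) sums 1"
  shows "\<not> p \<longlonglongrightarrow> q"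
proof
  assume p: "p \<longlonglongrightarrow> q"
  have mean_exp: "(\<lambda>k. mean_exp (\<tau> k) n) \<longlonglongrightarrow> 1" for n
    using filterlim_compose[OF \<sigma>_limit[of n] \<tau>] by (simp add: mean_exp_def)
  have den: "(\<lambda>k. p k - lam n * mean_exp (\<tau> k) n) \<longlonglongrightarrow> q - lam n" for n
    using tendsto_diff[OF p tendsto_mult[OF tendsto_const mean_exp], of "lam n" n] by simp
  have quot: "(\<lambda>k. mean_exp (\<tau> k) n / (p k - lam n * mean_exp (\<tau> k) n)) \<longlonglongrightarrow> 1 / (q - lam n)" if "q \<noteq> lam n" for n
    using that by (intro tendsto_divide mean_exp den) simp
  have "\<tau> \<longlonglongrightarrow> 0" using \<tau> by (simp add: filterlim_at)
  have "Re q \<ge> 0"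
  proof (rule tendsto_lowerbound)
    \<comment> \<open>Squaring \<open>cmod (1 + \<tau> p) > 1\<close> makes this quantity
      nonnegative; its second term vanishes in the limit because \<open>p k\<close>
      converges.\<close>
    show "(\<lambda>k. Re (p k) + \<tau> k * (cmod (p k))\<^sup>2 / 2) \<longlonglongrightarrow> Re q"
      using \<open>\<tau> \<longlonglongrightarrow> 0\<close> p by (auto intro!: tendsto_eq_intros)
    have "0 \<le> Re (p k) + \<tau> k * (cmod (p k))\<^sup>2 / 2" for k
    proof -
      have "1 < (cmod (1 + of_real (\<tau> k) * p k))\<^sup>2"
        using big[of k] by (simp add: one_less_power)
      also have "\<dots> = 1 + 2 * \<tau> k * (Re (p k) + \<tau> k * (cmod (p k))\<^sup>2 / 2)"
        unfolding cmod_power2 by (simp add: power2_eq_square algebra_simps)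
      finally show ?thesis using pos[of k] by (simp add: zero_less_mult_iff)
    qed
    then show "\<forall>\<^sub>F k in sequentially. 0 \<le> Re (p k) + \<tau> k * (cmod (p k))\<^sup>2 / 2" by simp
  qed simp
  show False
  proof (cases "\<exists>m. q = lam m")
    case False
    then have lim: "(\<lambda>k. coupling n * (mean_exp (\<tau> k) n / (p k - lam n * mean_exp (\<tau> k) n))) \<longlonglongrightarrow> coupling n * (1 / (q - lam n))" for n
      by (intro tendsto_mult tendsto_const quot) auto
    have "(\<lambda>k. 1) \<longlonglongrightarrow> (\<Sum>n. coupling n * (1 / (q - lam n)))"
      using dominated_sums(1)[OF pos big order_refl lim] sums_unique[OF sums] by simp
    then have "(\<Sum>n. coupling n * (1 / (q - lam n))) = 1"
      by (simp add: LIMSEQ_const_iff)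
    then have "(\<lambda>n. coupling n / (q - lam n)) sums 1"
      using summable_sums[OF dominated_sums(2)[OF pos big order_refl lim]] by simp
    with transfer_function_ne_1[OF \<open>Re q \<ge> 0\<close>] False show False by blast
  next
    case True
    then obtain m where m: "q = lam m" by blast
    \<comment> \<open>Term \<open>m\<close> is the only one whose denominator tends to 0; with it
      deleted, the remaining sums converge.\<close>
    define a where "a = coupling(m := 0)"
    define S where "S k = (\<Sum>n. a n * (mean_exp (\<tau> k) n / (p k - lam n * mean_exp (\<tau> k) n)))" for k
    have "(\<lambda>k. a n * (mean_exp (\<tau> k) n / (p k - lam n * mean_exp (\<tau> k) n))) \<longlonglongrightarrow> a n * (1 / (q - lam n))" for n
    proof (cases "n = m")
      case False
      then have "q \<noteq> lam n" using m inj_lam by (auto dest: injD)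
      then show ?thesis by (intro tendsto_mult tendsto_const quot)
    qed (simp add: a_def)
    from dominated_sums(1)[OF pos big _ this]
    have S: "S \<longlonglongrightarrow> (\<Sum>n. a n * (1 / (q - lam n)))" by (simp add: S_def[abs_def] a_def)
    \<comment> \<open>This is the characteristic equation multiplied by its \<open>m\<close>-th
      denominator; the right side tends to 0 and the left side to \<open>coupling m\<close>.\<close>
    have "coupling m * mean_exp (\<tau> k) m = (p k - lam m * mean_exp (\<tau> k) m) * (1 - S k)" for k
    proof -
      let ?t = "\<lambda>n. mean_exp (\<tau> k) n / (p k - lam n * mean_exp (\<tau> k) n)"
      have "(\<lambda>n. coupling n * ?t n - (if n = m then coupling m * ?t m else 0)) sums (1 - coupling m * ?t m)"
        using sums[of k] sums_single[of m "\<lambda>_. coupling m * ?t m"] by (intro sums_diff) auto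
      moreover have "(\<lambda>n. coupling n * ?t n - (if n = m then coupling m * ?t m else 0)) = (\<lambda>n. a n * ?t n)"
        by (auto simp: a_def)
      ultimately have "S k = 1 - coupling m * ?t m"
        unfolding S_def by (simp add: sums_iff)
      then show ?thesis using reg[of k m] by (simp add: field_simps)
    qed
    moreover have "(\<lambda>k. (p k - lam m * mean_exp (\<tau> k) m) * (1 - S k)) \<longlonglongrightarrow> (q - lam m) * (1 - (\<Sum>n. a n * (1 / (q - lam n))))"
      by (intro tendsto_mult den tendsto_diff tendsto_const S)
    moreover have "(\<lambda>k. coupling m * mean_exp (\<tau> k) m) \<longlonglongrightarrow> coupling m * 1"
      by (intro tendsto_mult tendsto_const mean_exp)
    ultimately have "coupling m = 0"
      using m LIMSEQ_unique by fastforce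
    moreover have "coupling m \<noteq> 0"
      using unstable_mode_controllable[of m] unstable_mode_observable[of m] \<open>Re q \<ge> 0\<close> m by (simp add: coupling_def)
    ultimately show False by simp
  qed
qed

theorem exterior_in_resolvent_set:
  "\<exists>\<tau>s>0. \<forall>\<tau>. 0 < \<tau> \<and> \<tau> < \<tau>s \<longrightarrow> {z. cmod z > 1} \<subseteq> bounded_resolvent_set J (Delta J lam \<phi> \<psi> b f \<tau>)"
proof (rule ccontr)
  assume contra: "\<not> ?thesis"
  obtain \<tau>0 where \<tau>0: "\<tau>0 > 0" "\<And>\<tau> m n. 0 < \<tau> \<Longrightarrow> \<tau> < \<tau>0 \<Longrightarrow> m \<in> exceptional \<Longrightarrow> n \<in> exceptional \<Longrightarrow> m \<noteq> n \<Longrightarrow>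
      exp (complex_of_real \<tau> * lam m) \<noteq> exp (of_real \<tau> * lam n)"
    using eventually_simple_spectrum unfolding eventually_at_right_field by blast
  \<comment> \<open>Failure for every threshold yields counterexamples with \<open>\<tau> k\<close>
    tending to 0, kept below \<open>\<tau>0\<close> so that the exceptional exponentials stay
    distinct.\<close>
  have "\<exists>\<tau> z. 0 < \<tau> \<and> \<tau> < min \<tau>0 (inverse (real (Suc k))) \<and> cmod z > 1 \<and>
      z \<notin> bounded_resolvent_set J (Delta J lam \<phi> \<psi> b f \<tau>)" for k
  proof -
    have "min \<tau>0 (inverse (real (Suc k))) > 0" using \<tau>0(1) by simp
    with contra have "\<not> (\<forall>\<tau>. 0 < \<tau> \<and> \<tau> < min \<tau>0 (inverse (real (Suc k))) \<longrightarrow>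
        {z. cmod z > 1} \<subseteq> bounded_resolvent_set J (Delta J lam \<phi> \<psi> b f \<tau>))"
      by blast
    then show ?thesis by blast
  qed
  then have "\<forall>k. \<exists>\<tau> z. 0 < \<tau> \<and> \<tau> < min \<tau>0 (inverse (real (Suc k))) \<and> cmod z > 1 \<and>
      z \<notin> bounded_resolvent_set J (Delta J lam \<phi> \<psi> b f \<tau>)" by blast
  then obtain \<tau> z where pos: "\<And>k. 0 < \<tau> k" and small: "\<And>k. \<tau> k < \<tau>0" "\<And>k. \<tau> k < inverse (real (Suc k))"
    and z: "\<And>k. cmod (z k) > 1" and spec: "\<And>k. z k \<notin> bounded_resolvent_set J (Delta J lam \<phi> \<psi> b f (\<tau> k))"
    unfolding min_less_iff_conj choice_iff by blast
  have "\<tau> \<longlonglongrightarrow> 0"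
    by (rule tendsto_sandwich[OF _ _ tendsto_const LIMSEQ_inverse_real_of_nat])
      (use pos small(2) in \<open>auto intro!: always_eventually less_imp_le\<close>)
  then have \<tau>: "filterlim \<tau> (at_right 0) sequentially"
    using pos by (simp add: filterlim_at less_imp_neq[THEN not_sym])
  define p where "p k = (z k - 1) / of_real (\<tau> k)" for k
  have zp: "z k = 1 + of_real (\<tau> k) * p k" for k
    using pos[of k] by (simp add: p_def)
  \<comment> \<open>Otherwise \<open>m\<close> would be exceptional because
    \<open>cmod (z k) > 1\<close>, and \<open>z k\<close> would match no other mode, so
    \<open>unstable_spectrum_resolvent\<close> would put it in the resolvent set.\<close>
  have reg: "z k \<noteq> exp (of_real (\<tau> k) * lam m)" for k m
  proof
    assume m: "z k = exp (of_real (\<tau> k) * lam m)"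
    then have mE: "m \<in> exceptional" using norm_exp_off_exceptional[OF _ pos, of m k] z[of k] by force
    have "z k \<noteq> exp (of_real (\<tau> k) * lam n)" if "n \<noteq> m" for n
    proof (cases "n \<in> exceptional")
      case True
      then show ?thesis using \<tau>0(2)[OF pos small(1) mE True] that m by metis
    next
      case False
      then show ?thesis using norm_exp_off_exceptional[OF False pos, of k] z[of k] by force
    qed
    with unstable_spectrum_resolvent[OF pos z m] spec[of k] show False by blast
  qed
  have reg': "p k \<noteq> lam n * mean_exp (\<tau> k) n" for n k
  proof
    assume "p k = lam n * mean_exp (\<tau> k) n"
    then have "z k = exp (of_real (\<tau> k) * lam n)"
      using pos[of k] by (simp add: zp exp_eq_\<sigma> mean_exp_def)
    with reg show False by blast
  qed
  have sums: "(\<lambda>n. coupling n * (mean_exp (\<tau> k) n / (p k - lam n * mean_exp (\<tau> k) n))) sums 1" for k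
    using characteristic_equation[OF pos z reg spec, of k] unfolding zp quotient_rescaled[OF pos] .
  have big: "cmod (1 + of_real (\<tau> k) * p k) > 1" for k
    using z[of k] by (simp add: zp)
  \<comment> \<open>As \<open>p\<close> does not tend to infinity, it stays in a ball along a
    subsequence; compactness then gives a finite limit point, which \<open>no_finite_limit\<close>
    excludes.\<close>
  obtain R where "\<exists>\<^sub>F k in sequentially. \<not> R \<le> cmod (p k)"
    using no_limit_at_infinity[OF pos \<tau> big sums] unfolding filterlim_at_infinity[OF order_refl]
    by (auto simp: not_eventually)
  then have "\<exists>\<^sub>F k in sequentially. cmod (p k) \<le> R"
    by (rule frequently_elim1) simp
  then have "infinite {k. cmod (p k) \<le> R}"
    by (simp add: frequently_cofinite flip: cofinite_eq_sequentially)
  from infinite_enumerate[OF this] obtain g :: "nat \<Rightarrow> nat"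
    where g: "strict_mono g" "\<And>k. cmod (p (g k)) \<le> R" by blast
  have "\<forall>k. (p \<circ> g) k \<in> cball 0 R" using g(2) by simp
  then obtain q h where h: "strict_mono h" "((p \<circ> g) \<circ> h) \<longlonglongrightarrow> q"
    using compact_cball[of "0::complex" R] unfolding compact_def by blast
  have "filterlim (\<lambda>k. \<tau> (g (h k))) (at_right 0) sequentially"
    using \<tau> filterlim_subseq[OF strict_mono_o[OF g(1) h(1)]] by (auto simp: o_def intro: filterlim_compose)
  from no_finite_limit[OF pos this big reg' sums, of q] h(2) show False
    by (simp add: o_def)
qed

end

theorem mainTheorem4:
  fixes J :: "'a::{real_inner, complete_space} \<Rightarrow> 'a"
    and lam :: "nat \<Rightarrow> complex" and \<phi> \<psi> :: "nat \<Rightarrow> 'a" and b f :: 'a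
    and \<alpha> :: real
  assumes Jcs: "complex_structure J"
    and RS: "riesz_spectral_data J lam \<phi> \<psi>"
    and A1: "\<alpha> > 0 \<and> (\<exists>\<omega> \<Upsilon>. \<omega> > 0 \<and> \<Upsilon> > 0 \<and>
               finite {n. Re (lam n) > - \<omega> \<and> lam n \<notin> Omega_set \<alpha> \<Upsilon>})"
    and A3: "generates_poly_stable J (rs_dom J lam \<psi>)
               (\<lambda>x. rs_op J lam \<phi> \<psi> x + scaleC J (cinner J x f) b) \<alpha>"
    and A4: "\<exists>\<beta> \<gamma>. \<beta> \<ge> 0 \<and> \<gamma> \<ge> 0 \<and> b \<in> D_beta J lam \<psi> \<beta> \<and> f \<in> D_gamma_star J lam \<phi> \<gamma> \<and>
               ((\<beta> \<in> \<nat> \<and> \<gamma> \<in> \<nat> \<and> \<beta> + \<gamma> \<ge> \<alpha>) \<or> \<beta> + \<gamma> > \<alpha>)"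
  shows "\<exists>\<tau>s>0. \<forall>\<tau>. 0 < \<tau> \<and> \<tau> < \<tau>s \<longrightarrow>
           {z. cmod z > 1} \<subseteq> bounded_resolvent_set J (Delta J lam \<phi> \<psi> b f \<tau>)"
proof -
  obtain \<omega> \<Upsilon> where "\<omega> > 0" "\<Upsilon> > 0" "finite {n. Re (lam n) > - \<omega> \<and> lam n \<notin> Omega_set \<alpha> \<Upsilon>}"
    using A1 by blast
  moreover have "\<exists>\<beta> \<gamma>. \<beta> \<ge> 0 \<and> \<gamma> \<ge> 0 \<and> b \<in> D_beta J lam \<psi> \<beta> \<and> f \<in> D_gamma_star J lam \<phi> \<gamma> \<and> \<beta> + \<gamma> \<ge> \<alpha>"
    using A4 by (meson less_imp_le)
  ultimately interpret sampled_system J \<phi> \<psi> lam b f \<alpha> \<omega> \<Upsilon>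
    using Jcs RS A1 A3 by unfold_locales (auto simp: riesz_spectral_data_def)
  show ?thesis by (rule exterior_in_resolvent_set)
qed

end
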